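(* Let $p\neq 2$ be a prime. For every two finite undirected graphs $\Gamma_1$ and $\Gamma_2$ without loops and multiple edges, the graph $p$-groups $G(\Gamma_1)$ and $G(\Gamma_2)$ satisfy $$G(\Gamma_1)\cong G(\Gamma_2)\ \text{(as groups)}\quad\Longleftrightarrow\quad \Gamma_1\cong\Gamma_2\ \text{(as graphs)}.$$
   Context: Let $p\ne2$ be a prime and $\Gamma=(T,E)$ a finite undirected graph without loops and multiple edges, with vertex set $T=\{v_1,\dots,v_n\}$ and edge set $E$. Let $V$ be the vector space over $\mathbb{F}_p=\mathbb{Z}/p\mathbb{Z}$ with basis $v_1,\dots,v_n$, and $\wedge^2V$ its exterior square. Let $M_n$ be the group whose underlying set is $V\oplus\wedge^2V$ and whose multiplication is $$(x_1+w_1)(x_2+w_2)=x_1+x_2+w_1+w_2+\tfrac12\,(x_1\wedge x_2),\qquad x_1,x_2\in V,\ w_1,w_2\in\wedge^2V.$$ (It is the free group on $T$ in the variety of groups defined by the identities $x^p=1$, $[[x,y],z]=1$.) Let $J$ be the subgroup of $M_n$ generated by the elements $v_i\wedge v_j$ with $\{v_i,v_j\}\in E$; it is normal in $M_n$. The graph $p$-group corresponding to $\Gamma$ is $G(\Gamma)=M_n/J$. *)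

theory Defs
  imports "HOL-Algebra.Module" "HOL-Number_Theory.Residues"
begin

section \<open>The free module on a finite set and its exterior square\<close>

text \<open>The fields \<open>mult\<close> and \<open>one\<close> of the module record are irrelevant. For finite \<open>I\<close> this is
  the free \<open>R\<close>-module on \<open>I\<close>, see \<open>free_mod_expansion\<close>.\<close>

definition free_mod :: "('r, 's) ring_scheme \<Rightarrow> 'i set \<Rightarrow> ('r, 'i \<Rightarrow> 'r) module" where
  "free_mod R I =
    \<lparr>carrier = I \<rightarrow>\<^sub>E carrier R,
     monoid.mult = undefined,
     one = undefined,
     ring.zero = (\<lambda>i\<in>I. \<zero>\<^bsub>R\<^esub>),
     ring.add = (\<lambda>x y. \<lambda>i\<in>I. x i \<oplus>\<^bsub>R\<^esub> y i),
     module.smult = (\<lambda>a x. \<lambda>i\<in>I. a \<otimes>\<^bsub>R\<^esub> x i)\<rparr>"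

definition basis_vec :: "('r, 's) ring_scheme \<Rightarrow> 'i set \<Rightarrow> 'i \<Rightarrow> 'i \<Rightarrow> 'r" where
  "basis_vec R I u = (\<lambda>i\<in>I. if i = u then \<one>\<^bsub>R\<^esub> else \<zero>\<^bsub>R\<^esub>)"

text \<open>The exterior square of \<open>free_mod R I\<close>, realised by the alternating \<open>I \<times> I\<close> matrices, with
  \<open>x \<and> y\<close> the matrix \<open>x y\<^sup>t - y x\<^sup>t\<close>. No order on \<open>I\<close> is needed. That this is the exterior square
  (universal property for alternating bilinear maps) is shown, for finite \<open>I\<close> and \<open>\<one> \<oplus> \<one>\<close> a unit, in \<open>ext_square_universal\<close>
  and \<open>ext_square_unique\<close>.\<close>

definition ext_square :: "('r, 's) ring_scheme \<Rightarrow> 'i set \<Rightarrow> ('r, 'i \<times> 'i \<Rightarrow> 'r) module" where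
  "ext_square R I = (free_mod R (I \<times> I))
    \<lparr>carrier := {w \<in> I \<times> I \<rightarrow>\<^sub>E carrier R.
       (\<forall>u\<in>I. w (u, u) = \<zero>\<^bsub>R\<^esub>) \<and> (\<forall>u\<in>I. \<forall>v\<in>I. w (v, u) = \<ominus>\<^bsub>R\<^esub> w (u, v))}\<rparr>"

definition wedge ::
    "('r, 's) ring_scheme \<Rightarrow> 'i set \<Rightarrow> ('i \<Rightarrow> 'r) \<Rightarrow> ('i \<Rightarrow> 'r) \<Rightarrow> 'i \<times> 'i \<Rightarrow> 'r" where
  "wedge R I x y = (\<lambda>(u, v)\<in>I \<times> I. x u \<otimes>\<^bsub>R\<^esub> y v \<ominus>\<^bsub>R\<^esub> x v \<otimes>\<^bsub>R\<^esub> y u)"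


section \<open>Graphs and graph groups\<close>

definition simple_graph :: "'a set \<Rightarrow> 'a set set \<Rightarrow> bool" where
  "simple_graph T E \<longleftrightarrow> finite T \<and> (\<forall>e\<in>E. \<exists>u\<in>T. \<exists>v\<in>T. u \<noteq> v \<and> e = {u, v})"

definition graph_iso :: "'a set \<Rightarrow> 'a set set \<Rightarrow> 'b set \<Rightarrow> 'b set set \<Rightarrow> bool" where
  "graph_iso T1 E1 T2 E2 \<longleftrightarrow>
    (\<exists>f. bij_betw f T1 T2 \<and> (\<forall>u\<in>T1. \<forall>v\<in>T1. {u, v} \<in> E1 \<longleftrightarrow> {f u, f v} \<in> E2))"

text \<open>The element \<open>x + w\<close> of the direct sum is the pair \<open>(x, w)\<close>. The definition is meaningful
  only if \<open>\<one> \<oplus> \<one>\<close> is a unit of \<open>R\<close>.\<close>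

definition free_nil2_group ::
    "('r, 's) ring_scheme \<Rightarrow> 'i set \<Rightarrow> (('i \<Rightarrow> 'r) \<times> ('i \<times> 'i \<Rightarrow> 'r)) monoid" where
  "free_nil2_group R I =
    (let V = free_mod R I; W = ext_square R I; half = inv\<^bsub>R\<^esub> (\<one>\<^bsub>R\<^esub> \<oplus>\<^bsub>R\<^esub> \<one>\<^bsub>R\<^esub>) in
    \<lparr>carrier = carrier V \<times> carrier W,
     monoid.mult = (\<lambda>(x1, w1) (x2, w2).
       (x1 \<oplus>\<^bsub>V\<^esub> x2, w1 \<oplus>\<^bsub>W\<^esub> w2 \<oplus>\<^bsub>W\<^esub> half \<odot>\<^bsub>W\<^esub> wedge R I x1 x2)),
     one = (\<zero>\<^bsub>V\<^esub>, \<zero>\<^bsub>W\<^esub>)\<rparr>)"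

definition edge_subgroup ::
    "('r, 's) ring_scheme \<Rightarrow> 'i set \<Rightarrow> 'i set set \<Rightarrow> (('i \<Rightarrow> 'r) \<times> ('i \<times> 'i \<Rightarrow> 'r)) set" where
  "edge_subgroup R I E = generate (free_nil2_group R I)
    {(\<zero>\<^bsub>free_mod R I\<^esub>, wedge R I (basis_vec R I u) (basis_vec R I v)) |u v. {u, v} \<in> E}"

definition graph_p_group ::
    "nat \<Rightarrow> 'a set \<Rightarrow> 'a set set \<Rightarrow> (('a \<Rightarrow> int) \<times> ('a \<times> 'a \<Rightarrow> int)) set monoid" where
  "graph_p_group p T E =
    free_nil2_group (residue_ring (int p)) T Mod edge_subgroup (residue_ring (int p)) T E"


section \<open>Well-definedness\<close>

lemma free_mod_simps:
  "carrier (free_mod R I) = I \<rightarrow>\<^sub>E carrier R"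
  "\<zero>\<^bsub>free_mod R I\<^esub> = (\<lambda>i\<in>I. \<zero>\<^bsub>R\<^esub>)"
  "x \<oplus>\<^bsub>free_mod R I\<^esub> y = (\<lambda>i\<in>I. x i \<oplus>\<^bsub>R\<^esub> y i)"
  "a \<odot>\<^bsub>free_mod R I\<^esub> x = (\<lambda>i\<in>I. a \<otimes>\<^bsub>R\<^esub> x i)"
  by (simp_all add: free_mod_def)

lemma ext_square_simps:
  "carrier (ext_square R I) = {w \<in> I \<times> I \<rightarrow>\<^sub>E carrier R.
       (\<forall>u\<in>I. w (u, u) = \<zero>\<^bsub>R\<^esub>) \<and> (\<forall>u\<in>I. \<forall>v\<in>I. w (v, u) = \<ominus>\<^bsub>R\<^esub> w (u, v))}"
  "\<zero>\<^bsub>ext_square R I\<^esub> = (\<lambda>i\<in>I \<times> I. \<zero>\<^bsub>R\<^esub>)"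
  "w \<oplus>\<^bsub>ext_square R I\<^esub> w' = (\<lambda>i\<in>I \<times> I. w i \<oplus>\<^bsub>R\<^esub> w' i)"
  "a \<odot>\<^bsub>ext_square R I\<^esub> w = (\<lambda>i\<in>I \<times> I. a \<otimes>\<^bsub>R\<^esub> w i)"
  by (simp_all add: ext_square_def free_mod_def)

lemma free_nil2_group_simps:
  "carrier (free_nil2_group R I) = carrier (free_mod R I) \<times> carrier (ext_square R I)"
  "(x1, w1) \<otimes>\<^bsub>free_nil2_group R I\<^esub> (x2, w2) =
    (x1 \<oplus>\<^bsub>free_mod R I\<^esub> x2, w1 \<oplus>\<^bsub>ext_square R I\<^esub> w2 \<oplus>\<^bsub>ext_square R I\<^esub>
      inv\<^bsub>R\<^esub> (\<one>\<^bsub>R\<^esub> \<oplus>\<^bsub>R\<^esub> \<one>\<^bsub>R\<^esub>) \<odot>\<^bsub>ext_square R I\<^esub> wedge R I x1 x2)"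
  "\<one>\<^bsub>free_nil2_group R I\<^esub> = (\<zero>\<^bsub>free_mod R I\<^esub>, \<zero>\<^bsub>ext_square R I\<^esub>)"
  by (simp_all add: free_nil2_group_def Let_def)

lemma module_free_mod:
  assumes "cring R" shows "module R (free_mod R I)"
proof -
  interpret cring R by fact
  have mem [simp]: "x i \<in> carrier R" if "x \<in> I \<rightarrow>\<^sub>E carrier R" "i \<in> I" for x i
    using that by (rule PiE_mem)
  have ext: "x = y" if "x \<in> I \<rightarrow>\<^sub>E carrier R" "y \<in> I \<rightarrow>\<^sub>E carrier R" "\<And>i. i \<in> I \<Longrightarrow> x i = y i"
    for x y
    using that by (rule PiE_ext)
  have "abelian_group (free_mod R I)"
  proof (rule abelian_groupI)
    fix x assume "x \<in> carrier (free_mod R I)"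
    then have "x i \<in> carrier R" if "i \<in> I" for i using that by (auto simp: free_mod_simps)
    then show "\<exists>y\<in>carrier (free_mod R I). y \<oplus>\<^bsub>free_mod R I\<^esub> x = \<zero>\<^bsub>free_mod R I\<^esub>"
      by (intro bexI[of _ "\<lambda>i\<in>I. \<ominus>\<^bsub>R\<^esub> x i"])
        (auto simp: free_mod_simps l_neg intro!: restrict_ext)
  qed (auto simp: free_mod_simps a_ac intro!: ext)
  then show ?thesis
    by (rule moduleI[OF assms])
      (auto simp: free_mod_simps l_distr r_distr m_assoc intro!: ext)
qed

lemma ext_square_mem:
  assumes "w \<in> carrier (ext_square R I)"
  shows "w \<in> I \<times> I \<rightarrow>\<^sub>E carrier R"
    and "u \<in> I \<Longrightarrow> v \<in> I \<Longrightarrow> w (u, v) \<in> carrier R"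
    and "u \<in> I \<Longrightarrow> w (u, u) = \<zero>\<^bsub>R\<^esub>"
    and "u \<in> I \<Longrightarrow> v \<in> I \<Longrightarrow> w (v, u) = \<ominus>\<^bsub>R\<^esub> w (u, v)"
  using assms unfolding ext_square_simps(1) by blast+

lemma ext_squareI:
  assumes "w \<in> I \<times> I \<rightarrow>\<^sub>E carrier R"
    and "\<And>u. u \<in> I \<Longrightarrow> w (u, u) = \<zero>\<^bsub>R\<^esub>"
    and "\<And>u v. u \<in> I \<Longrightarrow> v \<in> I \<Longrightarrow> w (v, u) = \<ominus>\<^bsub>R\<^esub> w (u, v)"
  shows "w \<in> carrier (ext_square R I)"
  using assms unfolding ext_square_simps(1) by blast

lemma module_ext_square:
  assumes "cring R" shows "module R (ext_square R I)"
proof -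
  interpret cring R by fact
  interpret F: module R "free_mod R (I \<times> I)" by (rule module_free_mod[OF assms])
  have neg: "\<ominus>\<^bsub>free_mod R (I \<times> I)\<^esub> x = (\<lambda>i\<in>I \<times> I. \<ominus>\<^bsub>R\<^esub> x i)"
    if "x \<in> I \<times> I \<rightarrow>\<^sub>E carrier R" for x
  proof (rule F.minus_equality)
    have "x i \<in> carrier R" if "i \<in> I \<times> I" for i using \<open>x \<in> _\<close> that by blast
    then show "(\<lambda>i\<in>I \<times> I. \<ominus>\<^bsub>R\<^esub> x i) \<in> carrier (free_mod R (I \<times> I))"
      and "(\<lambda>i\<in>I \<times> I. \<ominus>\<^bsub>R\<^esub> x i) \<oplus>\<^bsub>free_mod R (I \<times> I)\<^esub> x = \<zero>\<^bsub>free_mod R (I \<times> I)\<^esub>"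
      by (auto simp: free_mod_simps l_neg intro!: restrict_ext)
  qed (use that in \<open>simp add: free_mod_simps\<close>)
  have "submodule (carrier (ext_square R I)) R (free_mod R (I \<times> I))"
  proof (rule F.submoduleI)
    show "carrier (ext_square R I) \<subseteq> carrier (free_mod R (I \<times> I))"
      using ext_square_mem(1)[of _ R I] by (auto simp: free_mod_simps(1))
    show "\<zero>\<^bsub>free_mod R (I \<times> I)\<^esub> \<in> carrier (ext_square R I)"
      by (rule ext_squareI) (auto simp: free_mod_simps)
    fix w assume w: "w \<in> carrier (ext_square R I)"
    note mem = ext_square_mem[OF w]
    show "\<ominus>\<^bsub>free_mod R (I \<times> I)\<^esub> w \<in> carrier (ext_square R I)"
      unfolding neg[OF mem(1)]
    proof (rule ext_squareI)
      fix u v assume "u \<in> I" "v \<in> I"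
      then show "(\<lambda>i\<in>I \<times> I. \<ominus>\<^bsub>R\<^esub> w i) (v, u) = \<ominus>\<^bsub>R\<^esub> (\<lambda>i\<in>I \<times> I. \<ominus>\<^bsub>R\<^esub> w i) (u, v)"
        using mem(4)[of u v] by simp
    qed (use mem(2,3) in auto)
    show "a \<odot>\<^bsub>free_mod R (I \<times> I)\<^esub> w \<in> carrier (ext_square R I)" if a: "a \<in> carrier R" for a
      unfolding free_mod_simps
    proof (rule ext_squareI)
      fix u v assume "u \<in> I" "v \<in> I"
      then show "(\<lambda>i\<in>I \<times> I. a \<otimes>\<^bsub>R\<^esub> w i) (v, u) = \<ominus>\<^bsub>R\<^esub> (\<lambda>i\<in>I \<times> I. a \<otimes>\<^bsub>R\<^esub> w i) (u, v)"
        using mem(4)[of u v] mem(2)[of u v] a by (simp add: r_minus)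
    qed (use mem(2,3) a in auto)
    fix w' assume w': "w' \<in> carrier (ext_square R I)"
    note mem' = ext_square_mem[OF w']
    show "w \<oplus>\<^bsub>free_mod R (I \<times> I)\<^esub> w' \<in> carrier (ext_square R I)"
      unfolding free_mod_simps
    proof (rule ext_squareI)
      fix u v assume "u \<in> I" "v \<in> I"
      then show "(\<lambda>i\<in>I \<times> I. w i \<oplus>\<^bsub>R\<^esub> w' i) (v, u) = \<ominus>\<^bsub>R\<^esub> (\<lambda>i\<in>I \<times> I. w i \<oplus>\<^bsub>R\<^esub> w' i) (u, v)"
        using mem(4)[of u v] mem(2)[of u v] mem'(4)[of u v] mem'(2)[of u v] by (simp add: minus_add)
    qed (use mem(2,3) mem'(2,3) in auto)
  qed
  then have "module R ((free_mod R (I \<times> I))\<lparr>carrier := carrier (ext_square R I)\<rparr>)"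
    by (rule submodule.submodule_is_module) (rule F.module_axioms)
  then show ?thesis by (simp add: ext_square_def)
qed


context
  fixes R :: "('r, 's) ring_scheme" (structure) and I :: "'i set"
  assumes R: "cring R"
begin

interpretation R: cring R by (rule R)
interpretation V: module R "free_mod R I" by (rule module_free_mod[OF R])
interpretation W: module R "ext_square R I" by (rule module_ext_square[OF R])

lemma basis_vec_closed: "basis_vec R I u \<in> carrier (free_mod R I)"
  by (auto simp: free_mod_simps basis_vec_def)

lemma wedge_closed:
  assumes "x \<in> carrier (free_mod R I)" "y \<in> carrier (free_mod R I)"
  shows "wedge R I x y \<in> carrier (ext_square R I)"
proof -
  have c: "x i \<in> carrier R" "y i \<in> carrier R" if "i \<in> I" for i
    using assms that by (auto simp: free_mod_simps)
  then show ?thesis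
    by (auto simp: ext_square_simps wedge_def R.minus_eq R.minus_add R.a_comm R.r_neg R.m_comm)
qed

lemma wedge_self:
  assumes "x \<in> carrier (free_mod R I)"
  shows "wedge R I x x = \<zero>\<^bsub>ext_square R I\<^esub>"
proof -
  have c: "x i \<in> carrier R" if "i \<in> I" for i
    using assms that by (auto simp: free_mod_simps)
  then show ?thesis
    by (auto simp: ext_square_simps wedge_def R.minus_eq R.r_neg R.m_comm fun_eq_iff)
qed

lemma wedge_add:
  assumes "x \<in> carrier (free_mod R I)" "y \<in> carrier (free_mod R I)" "z \<in> carrier (free_mod R I)"
  shows "wedge R I (x \<oplus>\<^bsub>free_mod R I\<^esub> y) z = wedge R I x z \<oplus>\<^bsub>ext_square R I\<^esub> wedge R I y z"
    and "wedge R I z (x \<oplus>\<^bsub>free_mod R I\<^esub> y) = wedge R I z x \<oplus>\<^bsub>ext_square R I\<^esub> wedge R I z y"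
proof -
  have c: "x i \<in> carrier R" "y i \<in> carrier R" "z i \<in> carrier R" if "i \<in> I" for i
    using assms that by (auto simp: free_mod_simps)
  show "wedge R I (x \<oplus>\<^bsub>free_mod R I\<^esub> y) z = wedge R I x z \<oplus>\<^bsub>ext_square R I\<^esub> wedge R I y z"
    using c by (auto simp: ext_square_simps free_mod_simps wedge_def fun_eq_iff R.minus_eq
        R.l_distr R.r_distr R.minus_add R.a_ac)
  show "wedge R I z (x \<oplus>\<^bsub>free_mod R I\<^esub> y) = wedge R I z x \<oplus>\<^bsub>ext_square R I\<^esub> wedge R I z y"
    using c by (auto simp: ext_square_simps free_mod_simps wedge_def fun_eq_iff R.minus_eq
        R.l_distr R.r_distr R.minus_add R.a_ac)
qed

lemma wedge_smult:
  assumes "a \<in> carrier R" "x \<in> carrier (free_mod R I)" "z \<in> carrier (free_mod R I)"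
  shows "wedge R I (a \<odot>\<^bsub>free_mod R I\<^esub> x) z = a \<odot>\<^bsub>ext_square R I\<^esub> wedge R I x z"
    and "wedge R I z (a \<odot>\<^bsub>free_mod R I\<^esub> x) = a \<odot>\<^bsub>ext_square R I\<^esub> wedge R I z x"
proof -
  have c: "x i \<in> carrier R" "z i \<in> carrier R" if "i \<in> I" for i
    using assms that by (auto simp: free_mod_simps)
  show "wedge R I (a \<odot>\<^bsub>free_mod R I\<^esub> x) z = a \<odot>\<^bsub>ext_square R I\<^esub> wedge R I x z"
    using c assms(1) by (auto simp: ext_square_simps free_mod_simps wedge_def fun_eq_iff
        R.minus_eq R.r_distr R.r_minus R.m_assoc)
  show "wedge R I z (a \<odot>\<^bsub>free_mod R I\<^esub> x) = a \<odot>\<^bsub>ext_square R I\<^esub> wedge R I z x"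
    using c assms(1) by (auto simp: ext_square_simps free_mod_simps wedge_def fun_eq_iff
        R.minus_eq R.r_distr R.r_minus R.m_assoc R.m_lcomm)
qed

lemma wedge_zero:
  assumes "x \<in> carrier (free_mod R I)"
  shows "wedge R I \<zero>\<^bsub>free_mod R I\<^esub> x = \<zero>\<^bsub>ext_square R I\<^esub>"
    and "wedge R I x \<zero>\<^bsub>free_mod R I\<^esub> = \<zero>\<^bsub>ext_square R I\<^esub>"
  using wedge_smult[of \<zero> x x] assms wedge_smult[of \<zero> "\<zero>\<^bsub>free_mod R I\<^esub>" x] wedge_closed
  by auto

lemma wedge_swap:
  assumes "x \<in> carrier (free_mod R I)" "y \<in> carrier (free_mod R I)"
  shows "wedge R I y x = \<ominus>\<^bsub>ext_square R I\<^esub> wedge R I x y"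
proof -
  have "\<zero>\<^bsub>ext_square R I\<^esub> = wedge R I (x \<oplus>\<^bsub>free_mod R I\<^esub> y) (x \<oplus>\<^bsub>free_mod R I\<^esub> y)"
    using assms by (simp add: wedge_self)
  also have "\<dots> = wedge R I x y \<oplus>\<^bsub>ext_square R I\<^esub> wedge R I y x"
    using assms by (simp add: wedge_add wedge_self[of x] wedge_self[of y] wedge_closed W.a_comm)
  finally show ?thesis
    using assms by (metis W.a_comm W.minus_equality wedge_closed)
qed

context
  assumes two: "\<one> \<oplus> \<one> \<in> Units R"
begin

lemma half_closed: "inv (\<one> \<oplus> \<one>) \<in> carrier R"
  using two by simp

lemma group_free_nil2_group: "group (free_nil2_group R I)"
proof (rule groupI)
  let ?V = "free_mod R I" and ?W = "ext_square R I" and ?M = "free_nil2_group R I"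
  show "\<one>\<^bsub>?M\<^esub> \<in> carrier ?M" by (simp add: free_nil2_group_simps)
  fix g assume g: "g \<in> carrier ?M"
  obtain x w where gx: "g = (x, w)" by (cases g)
  have x: "x \<in> carrier ?V" and w: "w \<in> carrier ?W" using g gx by (auto simp: free_nil2_group_simps)
  show "\<one>\<^bsub>?M\<^esub> \<otimes>\<^bsub>?M\<^esub> g = g"
    using x w half_closed by (simp add: free_nil2_group_simps gx wedge_zero)
  have "wedge R I (\<ominus>\<^bsub>?V\<^esub> x) x = \<zero>\<^bsub>?W\<^esub>"
    using wedge_add(1)[of "\<ominus>\<^bsub>?V\<^esub> x" x x] x wedge_zero(1)[OF x]
    by (simp add: wedge_self V.l_neg wedge_closed)
  then show "\<exists>h\<in>carrier ?M. h \<otimes>\<^bsub>?M\<^esub> g = \<one>\<^bsub>?M\<^esub>"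
    using x w half_closed
    by (intro bexI[of _ "(\<ominus>\<^bsub>?V\<^esub> x, \<ominus>\<^bsub>?W\<^esub> w)"])
      (simp_all add: gx free_nil2_group_simps V.l_neg W.l_neg)
  fix g' assume g': "g' \<in> carrier ?M"
  obtain x' w' where gx': "g' = (x', w')" by (cases g')
  have x': "x' \<in> carrier ?V" and w': "w' \<in> carrier ?W"
    using g' gx' by (auto simp: free_nil2_group_simps)
  show "g \<otimes>\<^bsub>?M\<^esub> g' \<in> carrier ?M"
    using x w x' w' half_closed by (simp add: gx gx' free_nil2_group_simps wedge_closed)
  fix g'' assume g'': "g'' \<in> carrier ?M"
  obtain x'' w'' where gx'': "g'' = (x'', w'')" by (cases g'')
  have x'': "x'' \<in> carrier ?V" and w'': "w'' \<in> carrier ?W"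
    using g'' gx'' by (auto simp: free_nil2_group_simps)
  show "g \<otimes>\<^bsub>?M\<^esub> g' \<otimes>\<^bsub>?M\<^esub> g'' = g \<otimes>\<^bsub>?M\<^esub> (g' \<otimes>\<^bsub>?M\<^esub> g'')"
    using x w x' w' x'' w'' half_closed
    by (simp add: gx gx' gx'' free_nil2_group_simps wedge_closed wedge_add W.smult_r_distr
        V.a_assoc W.a_ac)
qed

lemma edge_subgroup_normal: "edge_subgroup R I E \<lhd> free_nil2_group R I"
proof -
  let ?V = "free_mod R I" and ?W = "ext_square R I" and ?M = "free_nil2_group R I"
  interpret M: group ?M by (rule group_free_nil2_group)
  let ?S = "{(\<zero>\<^bsub>?V\<^esub>, wedge R I (basis_vec R I u) (basis_vec R I v)) |u v. {u, v} \<in> E}"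
  have S: "?S \<subseteq> carrier ?M"
    by (auto simp: free_nil2_group_simps(1) wedge_closed basis_vec_closed)
  have J: "edge_subgroup R I E = generate ?M ?S"
    by (simp add: edge_subgroup_def)
  have sub: "subgroup (edge_subgroup R I E) ?M"
    unfolding J using S by (rule M.generate_is_subgroup)
  have central: "g \<otimes>\<^bsub>?M\<^esub> s = s \<otimes>\<^bsub>?M\<^esub> g" if "g \<in> carrier ?M" "s \<in> ?S" for g s
    using that half_closed
    by (cases g) (auto simp: free_nil2_group_simps wedge_zero wedge_closed basis_vec_closed W.a_comm)
  have comm: "g \<otimes>\<^bsub>?M\<^esub> h = h \<otimes>\<^bsub>?M\<^esub> g" if g: "g \<in> carrier ?M" and "h \<in> generate ?M ?S" for g h
    using that(2)
  proof (induction rule: generate.induct)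
    case one then show ?case using g by simp
  next
    case (incl h) then show ?case using central[OF g] by blast
  next
    case (inv h)
    then have h: "h \<in> carrier ?M" using S by blast
    have "g = h \<otimes>\<^bsub>?M\<^esub> g \<otimes>\<^bsub>?M\<^esub> inv\<^bsub>?M\<^esub> h"
      using central[OF g inv] g h by (metis M.inv_solve_right M.m_closed)
    then show ?case
      using g h by (simp add: M.inv_solve_left M.m_assoc)
  next
    case (eng h1 h2)
    have h1: "h1 \<in> carrier ?M" and h2: "h2 \<in> carrier ?M"
      using M.generate_in_carrier[OF S eng(1)] M.generate_in_carrier[OF S eng(2)] by this+
    show ?case using eng(3,4) g h1 h2 by (metis M.m_assoc)
  qed
  show ?thesis
  proof (rule M.normal_invI[OF sub])
    fix g h assume g: "g \<in> carrier ?M" and h: "h \<in> edge_subgroup R I E"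
    then have hc: "h \<in> carrier ?M" using subgroup.subset[OF sub] by blast
    have "g \<otimes>\<^bsub>?M\<^esub> h \<otimes>\<^bsub>?M\<^esub> inv\<^bsub>?M\<^esub> g = h"
      using comm[OF g] h g hc by (simp add: J M.m_assoc)
    then show "g \<otimes>\<^bsub>?M\<^esub> h \<otimes>\<^bsub>?M\<^esub> inv\<^bsub>?M\<^esub> g \<in> edge_subgroup R I E" using h by simp
  qed
qed

end

end

lemma residue_ring_two_unit:
  assumes "prime p" "p \<noteq> 2"
  shows "\<one>\<^bsub>residue_ring (int p)\<^esub> \<oplus>\<^bsub>residue_ring (int p)\<^esub> \<one>\<^bsub>residue_ring (int p)\<^esub> \<in> Units (residue_ring (int p))"
proof -
  interpret residues_prime p "residue_ring (int p)"
    using assms(1) by (simp_all add: residues_prime_def)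
  have p: "p > 2" using assms prime_ge_2_nat[of p] by linarith
  then have "\<one>\<^bsub>residue_ring (int p)\<^esub> \<oplus>\<^bsub>residue_ring (int p)\<^esub> \<one>\<^bsub>residue_ring (int p)\<^esub> = 2"
    by (simp add: residue_ring_def)
  then show ?thesis using p by (simp add: res_prime_units_eq)
qed

lemma edge_subgroup_residue_ring_normal:
  assumes "prime p" "p \<noteq> 2"
  shows "edge_subgroup (residue_ring (int p)) T E \<lhd> free_nil2_group (residue_ring (int p)) T"
proof -
  interpret residues_prime p "residue_ring (int p)"
    using assms(1) by (simp_all add: residues_prime_def)
  show ?thesis by (rule edge_subgroup_normal[OF cring residue_ring_two_unit[OF assms]])
qed

lemma group_graph_p_group:
  assumes "prime p" "p \<noteq> 2"
  shows "group (graph_p_group p T E)"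
  unfolding graph_p_group_def
  by (rule normal.factorgroup_is_group[OF edge_subgroup_residue_ring_normal[OF assms]])


section \<open>Universal property of the exterior square\<close>

definition linear_map ::
    "('r, 's) ring_scheme \<Rightarrow> ('r, 'm, 'u) module_scheme \<Rightarrow> ('r, 'n, 'v) module_scheme \<Rightarrow> ('m \<Rightarrow> 'n) \<Rightarrow> bool"
  where
  "linear_map R M N f \<longleftrightarrow> f \<in> carrier M \<rightarrow> carrier N \<and>
    (\<forall>x\<in>carrier M. \<forall>y\<in>carrier M. f (x \<oplus>\<^bsub>M\<^esub> y) = f x \<oplus>\<^bsub>N\<^esub> f y) \<and>
    (\<forall>a\<in>carrier R. \<forall>x\<in>carrier M. f (a \<odot>\<^bsub>M\<^esub> x) = a \<odot>\<^bsub>N\<^esub> f x)"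

definition alternating_bilinear ::
    "('r, 's) ring_scheme \<Rightarrow> ('r, 'm, 'u) module_scheme \<Rightarrow> ('r, 'n, 'v) module_scheme \<Rightarrow>
      ('m \<Rightarrow> 'm \<Rightarrow> 'n) \<Rightarrow> bool" where
  "alternating_bilinear R M N B \<longleftrightarrow>
    (\<forall>x\<in>carrier M. linear_map R M N (B x) \<and> linear_map R M N (\<lambda>y. B y x) \<and> B x x = \<zero>\<^bsub>N\<^esub>)"

lemma linear_map_finsum:
  assumes "module R M" "module R N" "linear_map R M N f" "g \<in> A \<rightarrow> carrier M"
  shows "f (finsum M g A) = finsum N (\<lambda>i. f (g i)) A"
proof -
  interpret M: module R M by fact
  interpret N: module R N by fact
  have f: "f x \<in> carrier N" if "x \<in> carrier M" for x
    using assms(3) that by (auto simp: linear_map_def)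
  have "f (\<zero>\<^bsub>R\<^esub> \<odot>\<^bsub>M\<^esub> \<zero>\<^bsub>M\<^esub>) = \<zero>\<^bsub>R\<^esub> \<odot>\<^bsub>N\<^esub> f \<zero>\<^bsub>M\<^esub>"
    using assms(3) M.zero_closed M.R.zero_closed unfolding linear_map_def by blast
  then have z: "f \<zero>\<^bsub>M\<^esub> = \<zero>\<^bsub>N\<^esub>" using f by simp
  show ?thesis using assms(4)
  proof (induction A rule: infinite_finite_induct)
    case (insert x F)
    have gF: "g \<in> F \<rightarrow> carrier M" "g x \<in> carrier M" using insert by auto
    have "f (g x \<oplus>\<^bsub>M\<^esub> finsum M g F) = f (g x) \<oplus>\<^bsub>N\<^esub> f (finsum M g F)"
      using assms(3) gF by (simp add: linear_map_def)
    moreover have "(\<lambda>i. f (g i)) \<in> F \<rightarrow> carrier N" using gF f by auto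
    ultimately show ?case using insert gF f by simp
  qed (simp_all add: z)
qed

lemma free_mod_finsum_apply:
  assumes "cring R" "g \<in> A \<rightarrow> carrier (free_mod R I)" "i \<in> I"
  shows "finsum (free_mod R I) g A i = (\<Oplus>\<^bsub>R\<^esub>j\<in>A. g j i)"
proof -
  interpret cring R by fact
  interpret V: module R "free_mod R I" by (rule module_free_mod[OF assms(1)])
  show ?thesis using assms(2)
  proof (induction A rule: infinite_finite_induct)
    case (insert x F)
    then have "g \<in> F \<rightarrow> carrier (free_mod R I)" "g x \<in> carrier (free_mod R I)"
      "(\<lambda>j. g j i) \<in> F \<rightarrow> carrier R" "g x i \<in> carrier R"
      using assms(3) by (auto simp: free_mod_simps)
    then show ?case using insert assms(3) by (simp add: free_mod_simps)
  qed (simp_all add: free_mod_simps assms(3))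
qed

lemma ext_square_finsum_apply:
  assumes "cring R" "g \<in> A \<rightarrow> carrier (ext_square R I)" "i \<in> I \<times> I"
  shows "finsum (ext_square R I) g A i = (\<Oplus>\<^bsub>R\<^esub>j\<in>A. g j i)"
proof -
  interpret cring R by fact
  interpret V: module R "ext_square R I" by (rule module_ext_square[OF assms(1)])
  have mem: "w i \<in> carrier R" if "w \<in> carrier (ext_square R I)" for w
    using ext_square_mem(2)[OF that] assms(3) by auto
  show ?thesis using assms(2)
  proof (induction A rule: infinite_finite_induct)
    case (insert x F)
    then have "g \<in> F \<rightarrow> carrier (ext_square R I)" "g x \<in> carrier (ext_square R I)"
      "(\<lambda>j. g j i) \<in> F \<rightarrow> carrier R" "g x i \<in> carrier R"
      using mem by auto
    then show ?case using insert assms(3) by (simp add: ext_square_simps(3))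
  qed (simp_all add: ext_square_simps assms(3))
qed

context
  fixes R :: "('r, 's) ring_scheme" (structure) and I :: "'i set"
  assumes R: "cring R" and fin: "finite I"
begin

interpretation R: cring R by (rule R)
interpretation V: module R "free_mod R I" by (rule module_free_mod[OF R])
interpretation W: module R "ext_square R I" by (rule module_ext_square[OF R])

lemma free_mod_expansion:
  assumes "x \<in> carrier (free_mod R I)"
  shows "x = (\<Oplus>\<^bsub>free_mod R I\<^esub>u\<in>I. x u \<odot>\<^bsub>free_mod R I\<^esub> basis_vec R I u)"
proof
  fix i
  let ?g = "\<lambda>u. x u \<odot>\<^bsub>free_mod R I\<^esub> basis_vec R I u"
  have xc: "x u \<in> carrier R" if "u \<in> I" for u using assms that by (auto simp: free_mod_simps)
  have g: "?g \<in> I \<rightarrow> carrier (free_mod R I)"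
    by (intro Pi_I V.smult_closed xc basis_vec_closed[OF R])
  show "x i = finsum (free_mod R I) ?g I i"
  proof (cases "i \<in> I")
    case True
    have "finsum (free_mod R I) ?g I i = (\<Oplus>u\<in>I. ?g u i)"
      by (rule free_mod_finsum_apply[OF R g True])
    also have "\<dots> = (\<Oplus>u\<in>I. if i = u then x u else \<zero>)"
      using xc True by (intro R.finsum_cong') (auto simp: free_mod_simps basis_vec_def)
    also have "\<dots> = x i" using R.finsum_singleton[OF True fin, of x] xc by auto
    finally show ?thesis by (rule sym)
  next
    case False
    have arb: "y i = undefined" if "y \<in> carrier (free_mod R I)" for y
      using that False unfolding free_mod_simps(1) by (rule PiE_arb)
    show ?thesis
      by (rule trans[OF arb[OF assms] arb[OF V.finsum_closed[OF g], symmetric]])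
  qed
qed

context
  assumes two: "\<one> \<oplus> \<one> \<in> Units R"
begin

lemma ext_square_expansion:
  assumes w: "w \<in> carrier (ext_square R I)"
  shows "w = inv (\<one> \<oplus> \<one>) \<odot>\<^bsub>ext_square R I\<^esub> (\<Oplus>\<^bsub>ext_square R I\<^esub>u\<in>I. \<Oplus>\<^bsub>ext_square R I\<^esub>v\<in>I.
    w (u, v) \<odot>\<^bsub>ext_square R I\<^esub> wedge R I (basis_vec R I u) (basis_vec R I v))"
    (is "w = ?h \<odot>\<^bsub>_\<^esub> ?s")
proof
  fix i
  let ?W = "ext_square R I"
  let ?e = "\<lambda>u v. wedge R I (basis_vec R I u) (basis_vec R I v)"
  have wc: "w (u, v) \<in> carrier R" if "u \<in> I" "v \<in> I" for u v
    using ext_square_mem(2)[OF w] that by blast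
  have ec: "?e u v \<in> carrier ?W" for u v
    by (rule wedge_closed[OF R basis_vec_closed[OF R] basis_vec_closed[OF R]])
  have g: "(\<lambda>v. w (u, v) \<odot>\<^bsub>?W\<^esub> ?e u v) \<in> I \<rightarrow> carrier ?W" if "u \<in> I" for u
    by (intro Pi_I W.smult_closed wc that ec)
  have sg: "(\<lambda>u. \<Oplus>\<^bsub>?W\<^esub>v\<in>I. w (u, v) \<odot>\<^bsub>?W\<^esub> ?e u v) \<in> I \<rightarrow> carrier ?W"
    using g by auto
  show "w i = (?h \<odot>\<^bsub>?W\<^esub> ?s) i"
  proof (cases "i \<in> I \<times> I")
    case True
    then obtain a b where i: "i = (a, b)" and a: "a \<in> I" and b: "b \<in> I" by blast
    have row: "(\<Oplus>v\<in>I. (w (u, v) \<odot>\<^bsub>?W\<^esub> ?e u v) i) =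
        (if a = u then w (u, b) else \<zero>) \<oplus> (if b = u then \<ominus> w (u, a) else \<zero>)" if u: "u \<in> I" for u
    proof -
      have "(\<Oplus>v\<in>I. (w (u, v) \<odot>\<^bsub>?W\<^esub> ?e u v) i) =
        (\<Oplus>v\<in>I. (if b = v then (if a = u then w (u, v) else \<zero>) else \<zero>) \<oplus>
           (if a = v then (if b = u then \<ominus> w (u, v) else \<zero>) else \<zero>))"
        using wc u a b
        by (intro R.finsum_cong') (auto simp: i ext_square_simps wedge_def basis_vec_def R.minus_eq
            R.r_minus R.r_neg)
      also have "\<dots> = (\<Oplus>v\<in>I. if b = v then (if a = u then w (u, v) else \<zero>) else \<zero>) \<oplus>
           (\<Oplus>v\<in>I. if a = v then (if b = u then \<ominus> w (u, v) else \<zero>) else \<zero>)"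
        using wc u by (intro R.finsum_addf) auto
      also have "\<dots> = (if a = u then w (u, b) else \<zero>) \<oplus> (if b = u then \<ominus> w (u, a) else \<zero>)"
        using wc u R.finsum_singleton[OF b fin, of "\<lambda>v. if a = u then w (u, v) else \<zero>"]
          R.finsum_singleton[OF a fin, of "\<lambda>v. if b = u then \<ominus> w (u, v) else \<zero>"]
        by auto
      finally show ?thesis .
    qed
    have "?s i = (\<Oplus>u\<in>I. (\<Oplus>\<^bsub>?W\<^esub>v\<in>I. w (u, v) \<odot>\<^bsub>?W\<^esub> ?e u v) i)"
      by (rule ext_square_finsum_apply[OF R sg True])
    also have "\<dots> = (\<Oplus>u\<in>I. (if a = u then w (u, b) else \<zero>) \<oplus> (if b = u then \<ominus> w (u, a) else \<zero>))"
      using wc a b row ext_square_finsum_apply[OF R g True]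
      by (intro R.finsum_cong') auto
    also have "\<dots> = (\<Oplus>u\<in>I. if a = u then w (u, b) else \<zero>) \<oplus> (\<Oplus>u\<in>I. if b = u then \<ominus> w (u, a) else \<zero>)"
      using wc a b by (intro R.finsum_addf) auto
    also have "\<dots> = w (a, b) \<oplus> \<ominus> w (b, a)"
      using wc a b R.finsum_singleton[OF a fin, of "\<lambda>u. w (u, b)"]
        R.finsum_singleton[OF b fin, of "\<lambda>u. \<ominus> w (u, a)"]
      by auto
    also have "\<dots> = w i \<oplus> w i"
      using a b wc ext_square_mem(4)[OF w a b] by (simp add: i)
    also have "\<dots> = (\<one> \<oplus> \<one>) \<otimes> w i"
      using wc a b by (simp add: i R.l_distr)
    finally have "(?h \<odot>\<^bsub>?W\<^esub> ?s) i = ?h \<otimes> ((\<one> \<oplus> \<one>) \<otimes> w i)"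
      using True by (simp add: ext_square_simps)
    also have "\<dots> = w i"
      using two wc a b by (simp add: i R.m_assoc[symmetric])
    finally show ?thesis by simp
  next
    case False
    then show ?thesis using PiE_arb[OF ext_square_mem(1)[OF w] False] by (simp add: ext_square_simps(4))
  qed
qed

lemma linear_map_expansion:
  assumes N: "module R N" and L: "linear_map R (ext_square R I) N L"
    and w: "w \<in> carrier (ext_square R I)"
  shows "L w = inv (\<one> \<oplus> \<one>) \<odot>\<^bsub>N\<^esub> (\<Oplus>\<^bsub>N\<^esub>u\<in>I. \<Oplus>\<^bsub>N\<^esub>v\<in>I.
    w (u, v) \<odot>\<^bsub>N\<^esub> L (wedge R I (basis_vec R I u) (basis_vec R I v)))"
proof -
  interpret N: module R N by fact
  let ?W = "ext_square R I"
  let ?e = "\<lambda>u v. wedge R I (basis_vec R I u) (basis_vec R I v)"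
  have wc: "w (u, v) \<in> carrier R" if "u \<in> I" "v \<in> I" for u v
    using ext_square_mem(2)[OF w] that by blast
  have ec: "?e u v \<in> carrier ?W" for u v
    by (rule wedge_closed[OF R basis_vec_closed[OF R] basis_vec_closed[OF R]])
  have g: "(\<lambda>v. w (u, v) \<odot>\<^bsub>?W\<^esub> ?e u v) \<in> I \<rightarrow> carrier ?W" if "u \<in> I" for u
    by (intro Pi_I W.smult_closed wc that ec)
  have sg: "(\<lambda>u. \<Oplus>\<^bsub>?W\<^esub>v\<in>I. w (u, v) \<odot>\<^bsub>?W\<^esub> ?e u v) \<in> I \<rightarrow> carrier ?W"
    using g by auto
  have Lc: "L z \<in> carrier N" if "z \<in> carrier ?W" for z
    using L that by (auto simp: linear_map_def)
  have Ls: "L (a \<odot>\<^bsub>?W\<^esub> z) = a \<odot>\<^bsub>N\<^esub> L z" if "a \<in> carrier R" "z \<in> carrier ?W" for a z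
    using L that by (simp add: linear_map_def)
  have "L w = L (inv (\<one> \<oplus> \<one>) \<odot>\<^bsub>?W\<^esub> (\<Oplus>\<^bsub>?W\<^esub>u\<in>I. \<Oplus>\<^bsub>?W\<^esub>v\<in>I. w (u, v) \<odot>\<^bsub>?W\<^esub> ?e u v))"
    using ext_square_expansion[OF w] by simp
  also have "\<dots> = inv (\<one> \<oplus> \<one>) \<odot>\<^bsub>N\<^esub> L (\<Oplus>\<^bsub>?W\<^esub>u\<in>I. \<Oplus>\<^bsub>?W\<^esub>v\<in>I. w (u, v) \<odot>\<^bsub>?W\<^esub> ?e u v)"
    using two sg by (intro Ls) auto
  also have "L (\<Oplus>\<^bsub>?W\<^esub>u\<in>I. \<Oplus>\<^bsub>?W\<^esub>v\<in>I. w (u, v) \<odot>\<^bsub>?W\<^esub> ?e u v) =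
      (\<Oplus>\<^bsub>N\<^esub>u\<in>I. L (\<Oplus>\<^bsub>?W\<^esub>v\<in>I. w (u, v) \<odot>\<^bsub>?W\<^esub> ?e u v))"
    by (rule linear_map_finsum[OF W.module_axioms N L sg])
  also have "\<dots> = (\<Oplus>\<^bsub>N\<^esub>u\<in>I. \<Oplus>\<^bsub>N\<^esub>v\<in>I. w (u, v) \<odot>\<^bsub>N\<^esub> L (?e u v))"
  proof (intro N.finsum_cong' refl)
    show "(\<lambda>u. \<Oplus>\<^bsub>N\<^esub>v\<in>I. w (u, v) \<odot>\<^bsub>N\<^esub> L (?e u v)) \<in> I \<rightarrow> carrier N"
      using wc ec Lc by (auto intro!: N.finsum_closed)
    fix u assume u: "u \<in> I"
    show "L (\<Oplus>\<^bsub>?W\<^esub>v\<in>I. w (u, v) \<odot>\<^bsub>?W\<^esub> ?e u v) = (\<Oplus>\<^bsub>N\<^esub>v\<in>I. w (u, v) \<odot>\<^bsub>N\<^esub> L (?e u v))"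
      unfolding linear_map_finsum[OF W.module_axioms N L g[OF u]]
      using wc ec Lc u by (intro N.finsum_cong') (auto simp: Ls)
  qed
  finally show ?thesis .
qed

theorem ext_square_unique:
  assumes "module R N"
    and "linear_map R (ext_square R I) N L" and "linear_map R (ext_square R I) N L'"
    and "\<And>x y. \<lbrakk>x \<in> carrier (free_mod R I); y \<in> carrier (free_mod R I)\<rbrakk> \<Longrightarrow>
      L (wedge R I x y) = L' (wedge R I x y)"
    and "w \<in> carrier (ext_square R I)"
  shows "L w = L' w"
  using assms by (simp add: linear_map_expansion basis_vec_closed[OF R])

theorem ext_square_universal:
  assumes N: "module R N" and B: "alternating_bilinear R (free_mod R I) N B"
  shows "\<exists>L. linear_map R (ext_square R I) N L \<and>
    (\<forall>x\<in>carrier (free_mod R I). \<forall>y\<in>carrier (free_mod R I). L (wedge R I x y) = B x y)"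
proof -
  interpret N: module R N by fact
  let ?V = "free_mod R I" and ?W = "ext_square R I"
  let ?b = "\<lambda>u v. B (basis_vec R I u) (basis_vec R I v)"
  let ?h = "inv (\<one> \<oplus> \<one>)"
  have h: "?h \<in> carrier R" using two by simp
  have e: "basis_vec R I u \<in> carrier ?V" for u by (rule basis_vec_closed[OF R])
  have lin: "linear_map R ?V N (B x)" "linear_map R ?V N (\<lambda>y. B y x)" and alt: "B x x = \<zero>\<^bsub>N\<^esub>"
    if "x \<in> carrier ?V" for x
    using B that by (auto simp: alternating_bilinear_def)
  have Bc: "B x y \<in> carrier N" if "x \<in> carrier ?V" "y \<in> carrier ?V" for x y
    using lin(1)[OF that(1)] that(2) by (auto simp: linear_map_def)
  have bc: "?b u v \<in> carrier N" for u v using Bc e by blast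
  have anti: "B y x = \<ominus>\<^bsub>N\<^esub> B x y" if x: "x \<in> carrier ?V" and y: "y \<in> carrier ?V" for x y
  proof -
    have xy: "x \<oplus>\<^bsub>?V\<^esub> y \<in> carrier ?V" using x y by simp
    have "\<zero>\<^bsub>N\<^esub> = B (x \<oplus>\<^bsub>?V\<^esub> y) (x \<oplus>\<^bsub>?V\<^esub> y)" using alt[OF xy] by simp
    also have "\<dots> = B (x \<oplus>\<^bsub>?V\<^esub> y) x \<oplus>\<^bsub>N\<^esub> B (x \<oplus>\<^bsub>?V\<^esub> y) y"
      using lin(1)[OF xy] x y by (simp add: linear_map_def)
    also have "\<dots> = B y x \<oplus>\<^bsub>N\<^esub> B x y"
      using lin(2)[OF x] lin(2)[OF y] x y Bc by (simp add: linear_map_def alt)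
    finally show ?thesis using x y Bc by (metis N.minus_equality)
  qed
  have expand: "B x y = (\<Oplus>\<^bsub>N\<^esub>u\<in>I. \<Oplus>\<^bsub>N\<^esub>v\<in>I. (x u \<otimes> y v) \<odot>\<^bsub>N\<^esub> ?b u v)"
    if x: "x \<in> carrier ?V" and y: "y \<in> carrier ?V" for x y
  proof -
    have xc: "x u \<in> carrier R" "y u \<in> carrier R" if "u \<in> I" for u
      using x y that by (auto simp: free_mod_simps)
    have one: "f z = (\<Oplus>\<^bsub>N\<^esub>u\<in>I. z u \<odot>\<^bsub>N\<^esub> f (basis_vec R I u))"
      if f: "linear_map R ?V N f" and z: "z \<in> carrier ?V" for f z
    proof -
      have zc: "z u \<in> carrier R" if "u \<in> I" for u using z that by (auto simp: free_mod_simps)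
      have g: "(\<lambda>u. z u \<odot>\<^bsub>?V\<^esub> basis_vec R I u) \<in> I \<rightarrow> carrier ?V" by (intro Pi_I V.smult_closed zc e)
      have "f z = f (\<Oplus>\<^bsub>?V\<^esub>u\<in>I. z u \<odot>\<^bsub>?V\<^esub> basis_vec R I u)"
        using free_mod_expansion[OF z] by simp
      also have "\<dots> = (\<Oplus>\<^bsub>N\<^esub>u\<in>I. f (z u \<odot>\<^bsub>?V\<^esub> basis_vec R I u))"
        by (rule linear_map_finsum[OF V.module_axioms N f g])
      also have "\<dots> = (\<Oplus>\<^bsub>N\<^esub>u\<in>I. z u \<odot>\<^bsub>N\<^esub> f (basis_vec R I u))"
        using f e zc by (intro N.finsum_cong') (auto simp: linear_map_def Pi_iff)
      finally show ?thesis .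
    qed
    have "B x y = (\<Oplus>\<^bsub>N\<^esub>u\<in>I. x u \<odot>\<^bsub>N\<^esub> B (basis_vec R I u) y)"
      using one[OF lin(2)[OF y] x] .
    also have "\<dots> = (\<Oplus>\<^bsub>N\<^esub>u\<in>I. x u \<odot>\<^bsub>N\<^esub> (\<Oplus>\<^bsub>N\<^esub>v\<in>I. y v \<odot>\<^bsub>N\<^esub> ?b u v))"
      using one[OF lin(1)[OF e] y] by simp
    also have "\<dots> = (\<Oplus>\<^bsub>N\<^esub>u\<in>I. \<Oplus>\<^bsub>N\<^esub>v\<in>I. (x u \<otimes> y v) \<odot>\<^bsub>N\<^esub> ?b u v)"
    proof (intro N.finsum_cong' refl)
      show "(\<lambda>u. \<Oplus>\<^bsub>N\<^esub>v\<in>I. (x u \<otimes> y v) \<odot>\<^bsub>N\<^esub> ?b u v) \<in> I \<rightarrow> carrier N"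
        using xc bc by (auto intro!: N.finsum_closed)
      fix u assume u: "u \<in> I"
      have "x u \<odot>\<^bsub>N\<^esub> (\<Oplus>\<^bsub>N\<^esub>v\<in>I. y v \<odot>\<^bsub>N\<^esub> ?b u v) = (\<Oplus>\<^bsub>N\<^esub>v\<in>I. x u \<odot>\<^bsub>N\<^esub> (y v \<odot>\<^bsub>N\<^esub> ?b u v))"
        using xc bc u by (intro N.finsum_smult_ldistr fin) auto
      also have "\<dots> = (\<Oplus>\<^bsub>N\<^esub>v\<in>I. (x u \<otimes> y v) \<odot>\<^bsub>N\<^esub> ?b u v)"
        using xc bc u by (intro N.finsum_cong') (auto simp: N.smult_assoc1)
      finally show "x u \<odot>\<^bsub>N\<^esub> (\<Oplus>\<^bsub>N\<^esub>v\<in>I. y v \<odot>\<^bsub>N\<^esub> ?b u v) = (\<Oplus>\<^bsub>N\<^esub>v\<in>I. (x u \<otimes> y v) \<odot>\<^bsub>N\<^esub> ?b u v)" .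
    qed
    finally show ?thesis .
  qed
  define S where "S w = (\<Oplus>\<^bsub>N\<^esub>u\<in>I. \<Oplus>\<^bsub>N\<^esub>v\<in>I. w (u, v) \<odot>\<^bsub>N\<^esub> ?b u v)" for w
  have Sc: "S w \<in> carrier N" if "w \<in> I \<times> I \<rightarrow> carrier R" for w
    unfolding S_def using that bc by (auto intro!: N.finsum_closed N.smult_closed)
  have S_cong: "S w = S w'" if "w \<in> I \<times> I \<rightarrow> carrier R" "\<And>u v. u \<in> I \<Longrightarrow> v \<in> I \<Longrightarrow> w (u, v) = w' (u, v)"
    for w w'
    unfolding S_def using that bc
    by (intro N.finsum_cong' refl)
      (auto intro!: N.finsum_closed N.smult_closed simp: Pi_iff)
  have S_add: "S (\<lambda>i. w i \<oplus> w' i) = S w \<oplus>\<^bsub>N\<^esub> S w'"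
    if "w \<in> I \<times> I \<rightarrow> carrier R" "w' \<in> I \<times> I \<rightarrow> carrier R" for w w'
  proof -
    have c: "w (u, v) \<in> carrier R" "w' (u, v) \<in> carrier R" if "u \<in> I" "v \<in> I" for u v
      using that \<open>w \<in> _\<close> \<open>w' \<in> _\<close> by auto
    have "S (\<lambda>i. w i \<oplus> w' i) = (\<Oplus>\<^bsub>N\<^esub>u\<in>I. (\<Oplus>\<^bsub>N\<^esub>v\<in>I. w (u, v) \<odot>\<^bsub>N\<^esub> ?b u v) \<oplus>\<^bsub>N\<^esub>
        (\<Oplus>\<^bsub>N\<^esub>v\<in>I. w' (u, v) \<odot>\<^bsub>N\<^esub> ?b u v))"
      unfolding S_def
    proof (intro N.finsum_cong' refl)
      show "(\<lambda>u. (\<Oplus>\<^bsub>N\<^esub>v\<in>I. w (u, v) \<odot>\<^bsub>N\<^esub> ?b u v) \<oplus>\<^bsub>N\<^esub> (\<Oplus>\<^bsub>N\<^esub>v\<in>I. w' (u, v) \<odot>\<^bsub>N\<^esub> ?b u v))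
          \<in> I \<rightarrow> carrier N"
        using c bc by (auto intro!: N.finsum_closed N.a_closed)
      fix u assume u: "u \<in> I"
      have "(\<Oplus>\<^bsub>N\<^esub>v\<in>I. (w (u, v) \<oplus> w' (u, v)) \<odot>\<^bsub>N\<^esub> ?b u v) =
          (\<Oplus>\<^bsub>N\<^esub>v\<in>I. w (u, v) \<odot>\<^bsub>N\<^esub> ?b u v \<oplus>\<^bsub>N\<^esub> w' (u, v) \<odot>\<^bsub>N\<^esub> ?b u v)"
        using c bc u by (intro N.finsum_cong' refl) (auto simp: N.smult_l_distr)
      also have "\<dots> = (\<Oplus>\<^bsub>N\<^esub>v\<in>I. w (u, v) \<odot>\<^bsub>N\<^esub> ?b u v) \<oplus>\<^bsub>N\<^esub> (\<Oplus>\<^bsub>N\<^esub>v\<in>I. w' (u, v) \<odot>\<^bsub>N\<^esub> ?b u v)"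
        using c bc u by (intro N.finsum_addf) auto
      finally show "(\<Oplus>\<^bsub>N\<^esub>v\<in>I. (w (u, v) \<oplus> w' (u, v)) \<odot>\<^bsub>N\<^esub> ?b u v) =
        (\<Oplus>\<^bsub>N\<^esub>v\<in>I. w (u, v) \<odot>\<^bsub>N\<^esub> ?b u v) \<oplus>\<^bsub>N\<^esub> (\<Oplus>\<^bsub>N\<^esub>v\<in>I. w' (u, v) \<odot>\<^bsub>N\<^esub> ?b u v)" .
    qed
    also have "\<dots> = S w \<oplus>\<^bsub>N\<^esub> S w'"
      unfolding S_def using c bc by (intro N.finsum_addf) (auto intro!: N.finsum_closed)
    finally show ?thesis .
  qed
  have S_smult: "S (\<lambda>i. a \<otimes> w i) = a \<odot>\<^bsub>N\<^esub> S w"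
    if "w \<in> I \<times> I \<rightarrow> carrier R" and a: "a \<in> carrier R" for a w
  proof -
    have c: "w (u, v) \<in> carrier R" if "u \<in> I" "v \<in> I" for u v
      using that \<open>w \<in> _\<close> by auto
    have "a \<odot>\<^bsub>N\<^esub> S w = (\<Oplus>\<^bsub>N\<^esub>u\<in>I. a \<odot>\<^bsub>N\<^esub> (\<Oplus>\<^bsub>N\<^esub>v\<in>I. w (u, v) \<odot>\<^bsub>N\<^esub> ?b u v))"
      unfolding S_def using c bc a by (intro N.finsum_smult_ldistr fin) (auto intro!: N.finsum_closed)
    also have "\<dots> = S (\<lambda>i. a \<otimes> w i)"
      unfolding S_def
    proof (intro N.finsum_cong' refl)
      show "(\<lambda>u. \<Oplus>\<^bsub>N\<^esub>v\<in>I. (a \<otimes> w (u, v)) \<odot>\<^bsub>N\<^esub> ?b u v) \<in> I \<rightarrow> carrier N"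
        using c bc a by (auto intro!: N.finsum_closed)
      fix u assume u: "u \<in> I"
      have "a \<odot>\<^bsub>N\<^esub> (\<Oplus>\<^bsub>N\<^esub>v\<in>I. w (u, v) \<odot>\<^bsub>N\<^esub> ?b u v) = (\<Oplus>\<^bsub>N\<^esub>v\<in>I. a \<odot>\<^bsub>N\<^esub> (w (u, v) \<odot>\<^bsub>N\<^esub> ?b u v))"
        using c bc u a by (intro N.finsum_smult_ldistr fin) auto
      also have "\<dots> = (\<Oplus>\<^bsub>N\<^esub>v\<in>I. (a \<otimes> w (u, v)) \<odot>\<^bsub>N\<^esub> ?b u v)"
        using c bc u a by (intro N.finsum_cong') (auto simp: N.smult_assoc1)
      finally show "a \<odot>\<^bsub>N\<^esub> (\<Oplus>\<^bsub>N\<^esub>v\<in>I. w (u, v) \<odot>\<^bsub>N\<^esub> ?b u v) =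
        (\<Oplus>\<^bsub>N\<^esub>v\<in>I. (a \<otimes> w (u, v)) \<odot>\<^bsub>N\<^esub> ?b u v)" .
    qed
    finally show ?thesis by simp
  qed
  have Wc: "w \<in> I \<times> I \<rightarrow> carrier R" if "w \<in> carrier ?W" for w
    using ext_square_mem(1)[OF that] by auto
  have "linear_map R ?W N (\<lambda>w. ?h \<odot>\<^bsub>N\<^esub> S w)"
    unfolding linear_map_def
  proof (intro conjI ballI)
    show "(\<lambda>w. ?h \<odot>\<^bsub>N\<^esub> S w) \<in> carrier ?W \<rightarrow> carrier N" using h Sc Wc by auto
    fix w assume w: "w \<in> carrier ?W"
    fix w' assume w': "w' \<in> carrier ?W"
    have "S (w \<oplus>\<^bsub>?W\<^esub> w') = S (\<lambda>i. w i \<oplus> w' i)"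
      using Wc[OF w] Wc[OF w'] by (intro S_cong) (auto simp: ext_square_simps(3,4) Pi_iff)
    then show "?h \<odot>\<^bsub>N\<^esub> S (w \<oplus>\<^bsub>?W\<^esub> w') = ?h \<odot>\<^bsub>N\<^esub> S w \<oplus>\<^bsub>N\<^esub> ?h \<odot>\<^bsub>N\<^esub> S w'"
      using S_add Wc[OF w] Wc[OF w'] Sc h by (simp add: N.smult_r_distr)
  next
    fix a w assume a: "a \<in> carrier R" and w: "w \<in> carrier ?W"
    have "S (a \<odot>\<^bsub>?W\<^esub> w) = S (\<lambda>i. a \<otimes> w i)"
      using Wc[OF w] a by (intro S_cong) (auto simp: ext_square_simps(3,4) Pi_iff)
    then show "?h \<odot>\<^bsub>N\<^esub> S (a \<odot>\<^bsub>?W\<^esub> w) = a \<odot>\<^bsub>N\<^esub> (?h \<odot>\<^bsub>N\<^esub> S w)"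
      using S_smult[OF Wc[OF w] a] Sc[OF Wc[OF w]] h a
      by (simp add: N.smult_assoc1[symmetric] R.m_comm)
  qed
  moreover have "?h \<odot>\<^bsub>N\<^esub> S (wedge R I x y) = B x y"
    if x: "x \<in> carrier ?V" and y: "y \<in> carrier ?V" for x y
  proof -
    have c: "x u \<in> carrier R" "y u \<in> carrier R" if "u \<in> I" for u
      using x y that by (auto simp: free_mod_simps)
    define m where "m = (\<lambda>(u, v). x u \<otimes> y v)"
    define m' where "m' = (\<lambda>(u, v). y u \<otimes> x v)"
    have m: "m \<in> I \<times> I \<rightarrow> carrier R" "m' \<in> I \<times> I \<rightarrow> carrier R"
      using c by (auto simp: m_def m'_def)
    have Sm: "S m = B x y" "S m' = B y x"
      unfolding expand[OF x y] expand[OF y x] S_def by (simp_all add: m_def m'_def)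
    have neg: "(\<lambda>i. (\<ominus> \<one>) \<otimes> m' i) \<in> I \<times> I \<rightarrow> carrier R" using m by auto
    have "S (wedge R I x y) = S (\<lambda>i. m i \<oplus> (\<ominus> \<one>) \<otimes> m' i)"
      using c by (intro S_cong)
        (auto simp: wedge_def m_def m'_def R.minus_eq R.l_minus R.m_comm)
    also have "\<dots> = B x y \<oplus>\<^bsub>N\<^esub> (\<ominus> \<one>) \<odot>\<^bsub>N\<^esub> B y x"
      using S_add[OF m(1) neg] S_smult[OF m(2), of "\<ominus> \<one>"] Sm by simp
    also have "\<dots> = B x y \<oplus>\<^bsub>N\<^esub> B x y"
      using Bc x y by (simp add: anti[OF x y] N.smult_l_minus)
    also have "\<dots> = (\<one> \<oplus> \<one>) \<odot>\<^bsub>N\<^esub> B x y"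
      using Bc x y by (simp add: N.smult_l_distr)
    finally show ?thesis
      using two h Bc x y by (simp add: N.smult_assoc1[symmetric])
  qed
  ultimately show ?thesis by blast
qed

end

end

end

theory Submission
  imports Defs
begin

text \<open>An isomorphism of the groups induces a linear isomorphism \<open>\<phi>\<close> of their abelianizations \<open>V\<close>
  that preserves the relation ``\<open>x\<close> and \<open>y\<close> commute'', that is, \<open>x u y v = x v y u\<close> for all
  non-adjacent \<open>u\<close>, \<open>v\<close>. As the matrix of \<open>\<phi>\<close> is invertible, there is a bijection \<open>f\<close> of the vertices
  such that the \<open>f v\<close> coordinate of \<open>\<phi> v\<close> is nonzero for all \<open>v\<close>, and any such \<open>f\<close> is a graph
  isomorphism. Indeed, if \<open>x a \<noteq> 0\<close> then the centralizer of \<open>x\<close> has at most \<open>q ^ card (star a)\<close>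
  elements, with equality for \<open>x = a\<close>. Hence \<open>f\<close> does not decrease the size of stars, so by symmetry
  it preserves it. In this equality case all neighbours of \<open>f v\<close> commute with \<open>\<phi> v\<close>, and this
  excludes that an edge is mapped to a non-edge.\<close>

section \<open>Matchings in the support of an invertible matrix\<close>

text \<open>Elimination replaces the expansion of a determinant: one row \<open>s\<close> is matched
  with a column \<open>t\<close>, and a right inverse of the remaining submatrix of \<open>A\<close>
  is obtained from \<open>B\<close> by column operations. This needs neither an order on the index
  sets nor that they have equal size.\<close>

lemma (in field) left_inverse_imp_matching:
  assumes "finite S" "finite T"
    and "\<And>s t. \<lbrakk>s \<in> S; t \<in> T\<rbrakk> \<Longrightarrow> A s t \<in> carrier R"
    and "\<And>t s. \<lbrakk>t \<in> T; s \<in> S\<rbrakk> \<Longrightarrow> B t s \<in> carrier R"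
    and "\<And>s u. \<lbrakk>s \<in> S; u \<in> S\<rbrakk> \<Longrightarrow> (\<Oplus>t\<in>T. A s t \<otimes> B t u) = (if s = u then \<one> else \<zero>)"
  shows "\<exists>f. inj_on f S \<and> f ` S \<subseteq> T \<and> (\<forall>s\<in>S. A s (f s) \<noteq> \<zero>)"
  using assms
proof (induction S arbitrary: T B rule: finite_induct)
  case empty
  then show ?case by simp
next
  case (insert s S)
  note A = insert.prems(2) and B = insert.prems(3) and AB = insert.prems(4)
  \<comment> \<open>The diagonal entry of the product at \<open>s\<close> is \<open>\<one>\<close>,
    so some summand is nonzero; both of its factors are then nonzero.\<close>
  have "\<exists>t\<in>T. A s t \<otimes> B t s \<noteq> \<zero>"
  proof (rule ccontr)
    assume "\<not> ?thesis"
    then have "(\<Oplus>t\<in>T. A s t \<otimes> B t s) = (\<Oplus>t\<in>T. \<zero>)"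
      by (intro finsum_cong') auto
    then show False using AB[of s s] by simp
  qed
  then obtain t where t: "t \<in> T" and nz: "A s t \<otimes> B t s \<noteq> \<zero>" by blast
  have b: "B t s \<in> Units R" and a: "A s t \<noteq> \<zero>"
    using nz A[of s t] B[of t s] t by (auto simp: field_Units)
  \<comment> \<open>Adding \<open>c u\<close> times column \<open>s\<close> of \<open>B\<close> to
    column \<open>u\<close> clears the entry in row \<open>t\<close>. Rows
    \<open>r \<noteq> s\<close> of the product do not change, because the product has entry
    \<open>\<zero>\<close> at \<open>(r, s)\<close>. Column \<open>t\<close> of \<open>A\<close> can
    then be dropped from the sums.\<close>
  define c where "c u = \<ominus> (inv (B t s) \<otimes> B t u)" for u
  have c: "c u \<in> carrier R" if "u \<in> S" for u
    unfolding c_def using b B[OF t, of u] that by simp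
  define B' where "B' t' u = B t' u \<oplus> B t' s \<otimes> c u" for t' u
  have B': "B' t' u \<in> carrier R" if "t' \<in> T" "u \<in> S" for t' u
    unfolding B'_def using B c that by simp
  have B't: "B' t u = \<zero>" if "u \<in> S" for u
    unfolding B'_def c_def using b B[OF t, of u] B[OF t, of s] that
    by (simp add: r_minus r_neg m_assoc[symmetric])
  have "\<exists>f. inj_on f S \<and> f ` S \<subseteq> T - {t} \<and> (\<forall>s\<in>S. A s (f s) \<noteq> \<zero>)"
  proof (rule insert.IH)
    show "finite (T - {t})" using insert.prems(1) by simp
    show "A r t' \<in> carrier R" if "r \<in> S" "t' \<in> T - {t}" for r t' using A that by simp
    show "B' t' r \<in> carrier R" if "t' \<in> T - {t}" "r \<in> S" for r t' using B' that by simp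
    fix r u assume r: "r \<in> S" and u: "u \<in> S"
    have rs: "r \<noteq> s" using r insert.hyps by blast
    have fin: "finite T" by (rule insert.prems(1))
    have "(\<Oplus>t'\<in>T. A r t' \<otimes> B' t' u) = (\<Oplus>t'\<in>T. A r t' \<otimes> B t' u \<oplus> (A r t' \<otimes> B t' s) \<otimes> c u)"
    proof (intro finsum_cong')
      fix t' assume "t' \<in> T"
      then show "A r t' \<otimes> B' t' u = A r t' \<otimes> B t' u \<oplus> (A r t' \<otimes> B t' s) \<otimes> c u"
        unfolding B'_def using A[of r t'] B[of t' u] B[of t' s] c[OF u] r u by (simp add: r_distr m_assoc)
    qed (use A[of r] B[of _ u] B[of _ s] c[OF u] r u in auto)
    also have "\<dots> = (\<Oplus>t'\<in>T. A r t' \<otimes> B t' u) \<oplus> (\<Oplus>t'\<in>T. (A r t' \<otimes> B t' s) \<otimes> c u)"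
      using A B c r u by (intro finsum_addf) auto
    also have "(\<Oplus>t'\<in>T. (A r t' \<otimes> B t' s) \<otimes> c u) = (\<Oplus>t'\<in>T. A r t' \<otimes> B t' s) \<otimes> c u"
      using A B c r u by (intro finsum_ldistr[symmetric] fin) auto
    finally have "(\<Oplus>t'\<in>T. A r t' \<otimes> B' t' u) = (if r = u then \<one> else \<zero>)"
      using AB[of r u] AB[of r s] r u rs c[OF u] by simp
    moreover have "(\<Oplus>t'\<in>T. A r t' \<otimes> B' t' u) =
        A r t \<otimes> B' t u \<oplus> (\<Oplus>t'\<in>T - {t}. A r t' \<otimes> B' t' u)"
      using finsum_insert[of "T - {t}" t "\<lambda>t'. A r t' \<otimes> B' t' u"] fin t A r B'[OF _ u]
      by (auto simp: insert_absorb)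
    ultimately show "(\<Oplus>t'\<in>T - {t}. A r t' \<otimes> B' t' u) = (if r = u then \<one> else \<zero>)"
      using A[of r] B'[OF _ u] r t by (simp add: B't[OF u] Pi_iff)
  qed
  then obtain f where f: "inj_on f S" "f ` S \<subseteq> T - {t}" "\<forall>s\<in>S. A s (f s) \<noteq> \<zero>" by blast
  have "inj_on (f(s := t)) (insert s S)"
    using f(1,2) insert.hyps by (auto simp: inj_on_def)
  moreover have "(f(s := t)) ` insert s S \<subseteq> T" using f(2) t insert.hyps by auto
  moreover have "\<forall>r\<in>insert s S. A r ((f(s := t)) r) \<noteq> \<zero>" using f(3) a insert.hyps by simp
  ultimately show ?case by blast
qed

section \<open>Centralizers in the free module\<close>

lemma free_mod_mem: "x \<in> carrier (free_mod R T) \<Longrightarrow> u \<in> T \<Longrightarrow> x u \<in> carrier R"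
  by (auto simp: free_mod_simps)

text \<open>The coordinate form of the statement that \<open>wedge R T x y\<close> vanishes at all
  non-edges. By \<open>cosets_commute_iff\<close> it means that lifts of \<open>x\<close> and
  \<open>y\<close> commute in the graph group.\<close>

definition commutes :: "('r, 's) ring_scheme \<Rightarrow> 'i set \<Rightarrow> 'i set set \<Rightarrow> ('i \<Rightarrow> 'r) \<Rightarrow> ('i \<Rightarrow> 'r) \<Rightarrow> bool"
  where "commutes R T E x y \<longleftrightarrow>
    (\<forall>u\<in>T. \<forall>v\<in>T. {u, v} \<notin> E \<longrightarrow> x u \<otimes>\<^bsub>R\<^esub> y v = x v \<otimes>\<^bsub>R\<^esub> y u)"

definition centralizer :: "('r, 's) ring_scheme \<Rightarrow> 'i set \<Rightarrow> 'i set set \<Rightarrow> ('i \<Rightarrow> 'r) \<Rightarrow> ('i \<Rightarrow> 'r) set"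
  where "centralizer R T E x = {y \<in> carrier (free_mod R T). commutes R T E x y}"

text \<open>The closed neighbourhood of \<open>a\<close>. The vertex \<open>a\<close> itself belongs
  to it because the coordinate at \<open>a\<close> determines all coordinates outside the
  neighbourhood in \<open>inj_on_restrict_centralizer\<close>.\<close>

definition star :: "'i set \<Rightarrow> 'i set set \<Rightarrow> 'i \<Rightarrow> 'i set"
  where "star T E a = {u \<in> T. u = a \<or> {u, a} \<in> E}"

definition supported :: "('r, 's) ring_scheme \<Rightarrow> 'i set \<Rightarrow> 'i set \<Rightarrow> ('i \<Rightarrow> 'r) set"
  where "supported R T A = {x \<in> carrier (free_mod R T). \<forall>u\<in>T - A. x u = \<zero>\<^bsub>R\<^esub>}"

locale finite_field = field R for R (structure) +
  assumes finite_carrier: "finite (carrier R)"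
begin

lemma card_carrier_gt_one: "1 < card (carrier R)"
proof -
  have "card {\<zero>, \<one>} \<le> card (carrier R)"
    by (rule card_mono[OF finite_carrier]) auto
  then show ?thesis by simp
qed

lemma finite_free_mod: "finite T \<Longrightarrow> finite (carrier (free_mod R T))"
  by (simp add: free_mod_simps finite_PiE finite_carrier)

lemma card_supported:
  assumes T: "finite T" and A: "A \<subseteq> T"
  shows "card (supported R T A) = card (carrier R) ^ card A"
proof -
  have "bij_betw (\<lambda>x. restrict x A) (supported R T A) (A \<rightarrow>\<^sub>E carrier R)"
  proof (rule bij_betwI[where g = "\<lambda>y. \<lambda>u\<in>T. if u \<in> A then y u else \<zero>"])
    show "(\<lambda>x. restrict x A) \<in> supported R T A \<rightarrow> (A \<rightarrow>\<^sub>E carrier R)"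
      using A by (auto simp: supported_def free_mod_simps)
    show "(\<lambda>y. \<lambda>u\<in>T. if u \<in> A then y u else \<zero>) \<in> (A \<rightarrow>\<^sub>E carrier R) \<rightarrow> supported R T A"
      by (auto simp: supported_def free_mod_simps)
    show "(\<lambda>u\<in>T. if u \<in> A then restrict x A u else \<zero>) = x" if "x \<in> supported R T A" for x
      using that A by (auto simp: supported_def free_mod_simps fun_eq_iff PiE_def extensional_def)
    show "restrict (\<lambda>u\<in>T. if u \<in> A then y u else \<zero>) A = y" if "y \<in> A \<rightarrow>\<^sub>E carrier R" for y
      using that A by (auto simp: fun_eq_iff PiE_def extensional_def)
  qed
  then have "card (supported R T A) = card (A \<rightarrow>\<^sub>E carrier R)" by (rule bij_betw_same_card)
  then show ?thesis using finite_subset[OF A T] by (simp add: card_funcsetE)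
qed

lemma commutes_sym:
  assumes "x \<in> carrier (free_mod R T)" "y \<in> carrier (free_mod R T)" "commutes R T E x y"
  shows "commutes R T E y x"
  unfolding commutes_def
proof (intro ballI impI)
  fix u v assume uv: "u \<in> T" "v \<in> T" "{u, v} \<notin> E"
  then show "y u \<otimes> x v = y v \<otimes> x u"
    using assms(3) free_mod_mem[OF assms(1)] free_mod_mem[OF assms(2)]
    unfolding commutes_def by (metis m_comm)
qed

lemma commutes_combination:
  assumes x: "x \<in> carrier (free_mod R T)" and y: "y \<in> carrier (free_mod R T)"
    and z: "z \<in> carrier (free_mod R T)" and a: "a \<in> carrier R" and b: "b \<in> carrier R"
    and "commutes R T E x z" "commutes R T E y z"
  shows "commutes R T E (a \<odot>\<^bsub>free_mod R T\<^esub> x \<oplus>\<^bsub>free_mod R T\<^esub> b \<odot>\<^bsub>free_mod R T\<^esub> y) z"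
  unfolding commutes_def
proof (intro ballI impI)
  fix u v assume uv: "u \<in> T" "v \<in> T" "{u, v} \<notin> E"
  have "x u \<otimes> z v = x v \<otimes> z u" "y u \<otimes> z v = y v \<otimes> z u"
    using assms(6,7) uv by (auto simp: commutes_def)
  then show "(a \<odot>\<^bsub>free_mod R T\<^esub> x \<oplus>\<^bsub>free_mod R T\<^esub> b \<odot>\<^bsub>free_mod R T\<^esub> y) u \<otimes> z v =
      (a \<odot>\<^bsub>free_mod R T\<^esub> x \<oplus>\<^bsub>free_mod R T\<^esub> b \<odot>\<^bsub>free_mod R T\<^esub> y) v \<otimes> z u"
    using uv a b free_mod_mem[OF x] free_mod_mem[OF y] free_mod_mem[OF z]
    by (simp add: free_mod_simps l_distr m_assoc)
qed

text \<open>If \<open>x a \<noteq> \<zero>\<close>, an element commuting with \<open>x\<close> is proportional to \<open>x\<close> outside the link of \<open>a\<close>.\<close>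

lemma inj_on_restrict_centralizer:
  assumes x: "x \<in> carrier (free_mod R T)" and a: "a \<in> T" "x a \<noteq> \<zero>"
  shows "inj_on (\<lambda>y. restrict y (star T E a)) (centralizer R T E x)"
proof (rule inj_onI)
  fix y y'
  assume y: "y \<in> centralizer R T E x" and y': "y' \<in> centralizer R T E x"
    and eq: "restrict y (star T E a) = restrict y' (star T E a)"
  have c: "y \<in> carrier (free_mod R T)" "y' \<in> carrier (free_mod R T)"
    using y y' by (auto simp: centralizer_def)
  have st: "y u = y' u" if "u \<in> star T E a" for u
    using fun_cong[OF eq, of u] that by simp
  show "y = y'"
  proof (rule PiE_ext)
    show "y \<in> T \<rightarrow>\<^sub>E carrier R" "y' \<in> T \<rightarrow>\<^sub>E carrier R" using c by (simp_all add: free_mod_simps)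
    fix u assume u: "u \<in> T"
    show "y u = y' u"
    proof (cases "u \<in> star T E a")
      case False
      then have "{a, u} \<notin> E" using u by (auto simp: star_def insert_commute)
      then have "x a \<otimes> y u = x u \<otimes> y a" "x a \<otimes> y' u = x u \<otimes> y' a"
        using y y' u a by (auto simp: centralizer_def commutes_def)
      moreover have "y a = y' a" using st a by (simp add: star_def)
      ultimately have "x a \<otimes> y u = x a \<otimes> y' u" by simp
      then show ?thesis
        using a u free_mod_mem[OF x] free_mod_mem[OF c(1)] free_mod_mem[OF c(2)]
        by (simp add: m_lcancel)
    qed (rule st)
  qed
qed

lemma restrict_centralizer_subset:
  "(\<lambda>y. restrict y (star T E a)) ` centralizer R T E x \<subseteq> star T E a \<rightarrow>\<^sub>E carrier R"
  by (auto simp: centralizer_def star_def free_mod_simps intro!: restrict_PiE_iff[THEN iffD2])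

lemma card_centralizer_le:
  assumes T: "finite T" and "x \<in> carrier (free_mod R T)" "a \<in> T" "x a \<noteq> \<zero>"
  shows "card (centralizer R T E x) \<le> card (carrier R) ^ card (star T E a)"
proof -
  have st: "finite (star T E a)" using T by (simp add: star_def)
  have "card (centralizer R T E x) \<le> card (star T E a \<rightarrow>\<^sub>E carrier R)"
    using inj_on_restrict_centralizer[OF assms(2-4)] restrict_centralizer_subset
    by (rule card_inj_on_le) (simp add: finite_PiE st finite_carrier)
  then show ?thesis using st by (simp add: card_funcsetE)
qed

text \<open>The condition at the pair of \<open>v\<close> and a non-neighbour
  \<open>u \<noteq> v\<close> reads \<open>y u = \<zero>\<close>. At pairs that avoid
  \<open>v\<close> both sides vanish, and at equal vertices they coincide.\<close>

lemma commutes_basis_vec_iff: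
  assumes T: "simple_graph T E" and v: "v \<in> T" and y: "y \<in> carrier (free_mod R T)"
  shows "commutes R T E (basis_vec R T v) y \<longleftrightarrow> y \<in> supported R T (star T E v)"
proof
  assume c: "commutes R T E (basis_vec R T v) y"
  have "y u = \<zero>" if "u \<in> T - star T E v" for u
  proof -
    have "u \<in> T" "u \<noteq> v" "{v, u} \<notin> E" using that v by (auto simp: star_def insert_commute)
    then have "basis_vec R T v v \<otimes> y u = basis_vec R T v u \<otimes> y v"
      using c v by (auto simp: commutes_def)
    then show ?thesis
      using \<open>u \<in> T\<close> \<open>u \<noteq> v\<close> v free_mod_mem[OF y] by (simp add: basis_vec_def)
  qed
  then show "y \<in> supported R T (star T E v)" using y by (simp add: supported_def)
next
  assume s: "y \<in> supported R T (star T E v)"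
  show "commutes R T E (basis_vec R T v) y"
    unfolding commutes_def
  proof (intro ballI impI)
    fix u w assume uw: "u \<in> T" "w \<in> T" "{u, w} \<notin> E"
    have "y w = \<zero>" if "u = v" "w \<noteq> v"
      using that uw s by (auto simp: supported_def star_def insert_commute)
    moreover have "y u = \<zero>" if "w = v" "u \<noteq> v"
      using that uw s by (auto simp: supported_def star_def insert_commute)
    ultimately show "basis_vec R T v u \<otimes> y w = basis_vec R T v w \<otimes> y u"
      using uw free_mod_mem[OF y] by (auto simp: basis_vec_def)
  qed
qed

lemma card_centralizer_basis_vec:
  assumes T: "simple_graph T E" and v: "v \<in> T"
  shows "card (centralizer R T E (basis_vec R T v)) = card (carrier R) ^ card (star T E v)"
proof -
  have "centralizer R T E (basis_vec R T v) = supported R T (star T E v)"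
    using commutes_basis_vec_iff[OF T v]
    by (auto simp: centralizer_def supported_def)
  then show ?thesis
    using T card_supported[of T "star T E v"] by (auto simp: simple_graph_def star_def)
qed

text \<open>In the equality case of \<open>card_centralizer_le\<close>, restriction to the star of
  \<open>a\<close> maps the centralizer onto all functions on the star. Hence some \<open>y\<close>
  commuting with \<open>x\<close> agrees there with the basis vector of \<open>c\<close>. As
  \<open>c \<noteq> a\<close>, this gives \<open>y a = \<zero>\<close>, so \<open>y\<close> also
  vanishes outside the star and is the basis vector itself.\<close>

lemma commutes_basis_vec_of_card:
  assumes T: "finite T" and x: "x \<in> carrier (free_mod R T)" and a: "a \<in> T" "x a \<noteq> \<zero>"
    and card: "card (centralizer R T E x) = card (carrier R) ^ card (star T E a)"
    and c: "c \<in> star T E a" "c \<noteq> a"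
  shows "commutes R T E x (basis_vec R T c)"
proof -
  have st: "finite (star T E a)" using T by (simp add: star_def)
  have cT: "c \<in> T" using c by (simp add: star_def)
  have "(\<lambda>y. restrict y (star T E a)) ` centralizer R T E x = (star T E a \<rightarrow>\<^sub>E carrier R)"
  proof (rule card_subset_eq[OF _ restrict_centralizer_subset])
    show "finite (star T E a \<rightarrow>\<^sub>E carrier R)" by (simp add: finite_PiE st finite_carrier)
    show "card ((\<lambda>y. restrict y (star T E a)) ` centralizer R T E x) = card (star T E a \<rightarrow>\<^sub>E carrier R)"
      using card_image[OF inj_on_restrict_centralizer[OF x a]] card st by (simp add: card_funcsetE)
  qed
  moreover have "restrict (basis_vec R T c) (star T E a) \<in> star T E a \<rightarrow>\<^sub>E carrier R"
    unfolding restrict_PiE_iff by (auto simp: basis_vec_def star_def)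
  ultimately obtain y where y: "y \<in> centralizer R T E x"
    and ys: "restrict (basis_vec R T c) (star T E a) = restrict y (star T E a)"
    by (metis (no_types, lifting) imageE)
  have yc: "y \<in> carrier (free_mod R T)" using y by (simp add: centralizer_def)
  have st_eq: "y u = (if u = c then \<one> else \<zero>)" if "u \<in> star T E a" for u
    using fun_cong[OF ys, of u] that by (auto simp: basis_vec_def star_def)
  have "y = basis_vec R T c"
  proof (rule PiE_ext)
    show "y \<in> T \<rightarrow>\<^sub>E carrier R" using yc by (simp add: free_mod_simps)
    show "basis_vec R T c \<in> T \<rightarrow>\<^sub>E carrier R" by (auto simp: basis_vec_def)
    fix u assume u: "u \<in> T"
    show "y u = basis_vec R T c u"
    proof (cases "u \<in> star T E a")
      case True
      then show ?thesis using st_eq u by (simp add: basis_vec_def)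
    next
      case False
      then have "{a, u} \<notin> E" using u by (auto simp: star_def insert_commute)
      then have "x a \<otimes> y u = x u \<otimes> y a"
        using y u a by (auto simp: centralizer_def commutes_def)
      moreover have "y a = \<zero>" using st_eq[of a] a c by (simp add: star_def)
      ultimately have "y u = \<zero>"
        using a u free_mod_mem[OF x] free_mod_mem[OF yc] by (auto simp: integral_iff)
      then show ?thesis using False c u by (auto simp: basis_vec_def)
    qed
  qed
  then show ?thesis using y by (simp add: centralizer_def)
qed

end

section \<open>Linear maps preserving commutation\<close>

text \<open>The assumptions are symmetric under exchanging the two graphs together with
  \<open>\<phi>\<close> and \<open>\<psi>\<close>, so each inequality proved here also holds in the
  opposite direction.\<close>

locale linear_graph_iso = finite_field R for R (structure) +
  fixes T1 :: "'t1 set" and E1 :: "'t1 set set" and T2 :: "'t2 set" and E2 :: "'t2 set set" and \<phi> \<psi>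
  assumes graph1: "simple_graph T1 E1" and graph2: "simple_graph T2 E2"
    and lin1: "linear_map R (free_mod R T1) (free_mod R T2) \<phi>"
    and lin2: "linear_map R (free_mod R T2) (free_mod R T1) \<psi>"
    and inv1: "x \<in> carrier (free_mod R T1) \<Longrightarrow> \<psi> (\<phi> x) = x"
    and inv2: "y \<in> carrier (free_mod R T2) \<Longrightarrow> \<phi> (\<psi> y) = y"
    and commutes1: "\<lbrakk>x \<in> carrier (free_mod R T1); x' \<in> carrier (free_mod R T1); commutes R T1 E1 x x'\<rbrakk>
      \<Longrightarrow> commutes R T2 E2 (\<phi> x) (\<phi> x')"
    and commutes2: "\<lbrakk>y \<in> carrier (free_mod R T2); y' \<in> carrier (free_mod R T2); commutes R T2 E2 y y'\<rbrakk>
      \<Longrightarrow> commutes R T1 E1 (\<psi> y) (\<psi> y')"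
begin

abbreviation V1 where "V1 \<equiv> free_mod R T1"
abbreviation V2 where "V2 \<equiv> free_mod R T2"
abbreviation e1 where "e1 \<equiv> basis_vec R T1"
abbreviation e2 where "e2 \<equiv> basis_vec R T2"

lemma fin: "finite T1" "finite T2"
  using graph1 graph2 by (simp_all add: simple_graph_def)

lemma closed1: "x \<in> carrier V1 \<Longrightarrow> \<phi> x \<in> carrier V2"
  using lin1 by (auto simp: linear_map_def)

lemma closed2: "y \<in> carrier V2 \<Longrightarrow> \<psi> y \<in> carrier V1"
  using lin2 by (auto simp: linear_map_def)

lemma card_centralizer_map:
  assumes x: "x \<in> carrier V1"
  shows "card (centralizer R T2 E2 (\<phi> x)) = card (centralizer R T1 E1 x)"
proof -
  have "bij_betw \<phi> (centralizer R T1 E1 x) (centralizer R T2 E2 (\<phi> x))"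
  proof (rule bij_betwI[where g = \<psi>])
    show "\<phi> \<in> centralizer R T1 E1 x \<rightarrow> centralizer R T2 E2 (\<phi> x)"
      using closed1 commutes1 x by (auto simp: centralizer_def)
    show "\<psi> \<in> centralizer R T2 E2 (\<phi> x) \<rightarrow> centralizer R T1 E1 x"
      using closed2 commutes2[OF closed1[OF x]] inv1[OF x] by (auto simp: centralizer_def)
  qed (auto simp: centralizer_def inv1 inv2)
  then show ?thesis by (rule bij_betw_same_card[symmetric])
qed

text \<open>The coordinates of \<open>\<phi> (e1 s)\<close> and \<open>\<psi> (e2 t)\<close> form
  matrices whose product is the identity: expand \<open>\<phi> (e1 s)\<close> in the basis
  \<open>e2\<close> and apply \<open>\<psi>\<close>.\<close>

lemma ex_matching: "\<exists>f. inj_on f T1 \<and> f ` T1 \<subseteq> T2 \<and> (\<forall>v\<in>T1. \<phi> (e1 v) (f v) \<noteq> \<zero>)"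
proof (rule left_inverse_imp_matching[OF fin, where B = "\<lambda>t. \<psi> (e2 t)"])
  have R: "cring R" by (rule is_cring)
  interpret V1: module R V1 by (rule module_free_mod[OF R])
  interpret V2: module R V2 by (rule module_free_mod[OF R])
  have e1: "e1 v \<in> carrier V1" for v by (rule basis_vec_closed[OF R])
  have e2: "e2 v \<in> carrier V2" for v by (rule basis_vec_closed[OF R])
  show A: "\<phi> (e1 s) t \<in> carrier R" if "t \<in> T2" for s t
    using free_mod_mem[OF closed1[OF e1]] that by blast
  show B: "\<psi> (e2 t) s \<in> carrier R" if "s \<in> T1" for s t
    using free_mod_mem[OF closed2[OF e2]] that by blast
  fix s u assume s: "s \<in> T1" and u: "u \<in> T1"
  let ?g = "\<lambda>t. \<phi> (e1 s) t \<odot>\<^bsub>V2\<^esub> e2 t"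
  have g: "?g \<in> T2 \<rightarrow> carrier V2" using A e2 by auto
  have g': "(\<lambda>t. \<psi> (?g t)) \<in> T2 \<rightarrow> carrier V1" using g closed2 by auto
  have "e1 s = \<psi> (\<phi> (e1 s))" by (rule inv1[OF e1, symmetric])
  also have "\<phi> (e1 s) = (\<Oplus>\<^bsub>V2\<^esub>t\<in>T2. ?g t)"
    by (rule free_mod_expansion[OF R fin(2) closed1[OF e1]])
  also have "\<psi> \<dots> = (\<Oplus>\<^bsub>V1\<^esub>t\<in>T2. \<psi> (?g t))"
    by (rule linear_map_finsum[OF V2.module_axioms V1.module_axioms lin2 g])
  finally have "e1 s u = (\<Oplus>\<^bsub>V1\<^esub>t\<in>T2. \<psi> (?g t)) u" by (rule fun_cong)
  also have "\<dots> = (\<Oplus>t\<in>T2. \<psi> (?g t) u)" by (rule free_mod_finsum_apply[OF R g' u])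
  also have "\<dots> = (\<Oplus>t\<in>T2. \<phi> (e1 s) t \<otimes> \<psi> (e2 t) u)"
  proof (rule finsum_cong'[OF refl])
    show "(\<lambda>t. \<phi> (e1 s) t \<otimes> \<psi> (e2 t) u) \<in> T2 \<rightarrow> carrier R" using A B u by auto
    fix t assume t: "t \<in> T2"
    have "\<psi> (?g t) = \<phi> (e1 s) t \<odot>\<^bsub>V1\<^esub> \<psi> (e2 t)"
      using lin2 A[OF t] e2 by (simp add: linear_map_def)
    then show "\<psi> (?g t) u = \<phi> (e1 s) t \<otimes> \<psi> (e2 t) u" using u by (simp add: free_mod_simps)
  qed
  finally show "(\<Oplus>t\<in>T2. \<phi> (e1 s) t \<otimes> \<psi> (e2 t) u) = (if s = u then \<one> else \<zero>)"
    using u by (auto simp: basis_vec_def)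
qed

text \<open>The centralizers of \<open>e1 v\<close> and of its image have the same size. For
  \<open>e1 v\<close> this size is exactly the power of \<open>card (carrier R)\<close> given by the
  star of \<open>v\<close>; for the image, the star of \<open>a\<close> bounds it from
  above.\<close>

lemma card_star_le:
  assumes v: "v \<in> T1" and a: "a \<in> T2" "\<phi> (e1 v) a \<noteq> \<zero>"
  shows "card (star T1 E1 v) \<le> card (star T2 E2 a)"
proof -
  have e: "e1 v \<in> carrier V1" by (rule basis_vec_closed[OF is_cring])
  have "card (carrier R) ^ card (star T1 E1 v) \<le> card (carrier R) ^ card (star T2 E2 a)"
    using card_centralizer_le[OF fin(2) closed1[OF e] a, of E2]
    by (simp add: card_centralizer_map[OF e] card_centralizer_basis_vec[OF graph1 v])
  then show ?thesis using card_carrier_gt_one by simp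
qed

text \<open>Sum \<open>card_star_le\<close> over a matching. Together with the same inequalities for
  the inverse map, this will force equality for every single matched pair.\<close>

lemma sum_card_star_le:
  "card T1 \<le> card T2 \<and> (\<Sum>v\<in>T1. card (star T1 E1 v)) \<le> (\<Sum>v\<in>T2. card (star T2 E2 v))"
proof -
  obtain f where f: "inj_on f T1" "f ` T1 \<subseteq> T2" "\<forall>v\<in>T1. \<phi> (e1 v) (f v) \<noteq> \<zero>"
    using ex_matching by blast
  have "(\<Sum>v\<in>T1. card (star T1 E1 v)) \<le> (\<Sum>v\<in>T1. card (star T2 E2 (f v)))"
    using f by (intro sum_mono card_star_le) auto
  also have "\<dots> = (\<Sum>v\<in>f ` T1. card (star T2 E2 v))" by (simp add: sum.reindex[OF f(1)])
  also have "\<dots> \<le> (\<Sum>v\<in>T2. card (star T2 E2 v))" using f(2) fin(2) by (intro sum_mono2) auto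
  finally show ?thesis using card_inj_on_le[OF f(1,2) fin(2)] by simp
qed

text \<open>If adjacent \<open>v\<close>, \<open>w\<close> were matched with non-adjacent \<open>a\<close>, \<open>b\<close>, then \<open>a\<close> and \<open>b\<close> would have the
  same link \<open>L\<close>, and some combination of \<open>e1 v\<close> and \<open>e1 w\<close> would be mapped into the span of \<open>L\<close>. The
  image then commutes with all of \<open>L \<union> {a, b}\<close>, so its centralizer is too big.\<close>

lemma matched_edge:
  assumes vw: "v \<in> T1" "w \<in> T1" "v \<noteq> w" "{v, w} \<in> E1"
    and ab: "a \<in> T2" "b \<in> T2" "a \<noteq> b" and xa: "\<phi> (e1 v) a \<noteq> \<zero>" and yb: "\<phi> (e1 w) b \<noteq> \<zero>"
    and card_a: "card (star T1 E1 v) = card (star T2 E2 a)"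
    and card_b: "card (star T1 E1 w) = card (star T2 E2 b)"
  shows "{a, b} \<in> E2"
proof (rule ccontr)
  assume n: "{a, b} \<notin> E2"
  interpret V1: module R V1 by (rule module_free_mod[OF is_cring])
  interpret V2: module R V2 by (rule module_free_mod[OF is_cring])
  have e1: "e1 v \<in> carrier V1" for v by (rule basis_vec_closed[OF is_cring])
  have e2: "e2 v \<in> carrier V2" for v by (rule basis_vec_closed[OF is_cring])
  define x where "x = \<phi> (e1 v)"
  define y where "y = \<phi> (e1 w)"
  have x: "x \<in> carrier V2" and y: "y \<in> carrier V2" by (simp_all add: x_def y_def closed1 e1)
  note mem = free_mod_mem[OF x] free_mod_mem[OF y]
  have "e1 w \<in> supported R T1 (star T1 E1 v)"
    using vw e1 by (auto simp: supported_def star_def basis_vec_def insert_commute)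
  then have "commutes R T1 E1 (e1 v) (e1 w)"
    using commutes_basis_vec_iff[OF graph1 vw(1) e1] by blast
  then have xy: "commutes R T2 E2 x y" unfolding x_def y_def by (rule commutes1[OF e1 e1])
  \<comment> \<open>Since \<open>a\<close> and \<open>b\<close> are not adjacent, the commutation of
    \<open>x\<close> and \<open>y\<close> gives an equation at this pair. Its left side is nonzero,
    hence so are both factors on the right.\<close>
  then have "x a \<otimes> y b = x b \<otimes> y a" using ab n unfolding commutes_def by blast
  then have xb: "x b \<noteq> \<zero>" and ya: "y a \<noteq> \<zero>"
    using xa yb ab mem by (auto simp: x_def[symmetric] y_def[symmetric] integral_iff)
  \<comment> \<open>By the assumed equality of star sizes, the centralizer of \<open>x\<close>
    attains its upper bound.\<close>
  have lk_x: "commutes R T2 E2 x (e2 c)" if "c \<in> star T2 E2 a" "c \<noteq> a" for c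
  proof (rule commutes_basis_vec_of_card[OF fin(2) x ab(1) _ _ that])
    show "x a \<noteq> \<zero>" using xa by (simp add: x_def)
    show "card (centralizer R T2 E2 x) = card (carrier R) ^ card (star T2 E2 a)"
      using card_centralizer_basis_vec[OF graph1 vw(1)]
      by (simp add: x_def card_centralizer_map[OF e1] card_a)
  qed
  have lk_y: "commutes R T2 E2 y (e2 c)" if "c \<in> star T2 E2 b" "c \<noteq> b" for c
  proof (rule commutes_basis_vec_of_card[OF fin(2) y ab(2) _ _ that])
    show "y b \<noteq> \<zero>" using yb by (simp add: y_def)
    show "card (centralizer R T2 E2 y) = card (carrier R) ^ card (star T2 E2 b)"
      using card_centralizer_basis_vec[OF graph1 vw(2)]
      by (simp add: y_def card_centralizer_map[OF e1] card_b)
  qed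
  have supp: "{c, d} \<in> E2"
    if "commutes R T2 E2 t (e2 c)" "t \<in> carrier V2" "t d \<noteq> \<zero>" "c \<in> T2" "d \<in> T2" "c \<noteq> d" for t c d
  proof -
    have "t \<in> supported R T2 (star T2 E2 c)"
      using commutes_basis_vec_iff[OF graph2 that(4,2)] commutes_sym[OF that(2) e2 that(1)] by blast
    then show ?thesis using that by (auto simp: supported_def star_def insert_commute)
  qed
  have nab: "a \<notin> star T2 E2 b" "b \<notin> star T2 E2 a"
    using n ab by (auto simp: star_def insert_commute)
  \<comment> \<open>Every neighbour \<open>c\<close> of \<open>a\<close> commutes with
    \<open>x\<close>, and \<open>x b \<noteq> \<zero>\<close>, so \<open>c\<close> is adjacent to
    \<open>b\<close>. The other inclusion uses \<open>y a \<noteq> \<zero>\<close>.\<close>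
  have link: "star T2 E2 a - {a} = star T2 E2 b - {b}"
  proof (intro subset_antisym subsetI)
    fix c assume c: "c \<in> star T2 E2 a - {a}"
    then have "c \<in> T2" "c \<noteq> b" using nab by (auto simp: star_def)
    moreover have "{c, b} \<in> E2" using supp[OF lk_x x xb] c ab calculation by simp
    ultimately show "c \<in> star T2 E2 b - {b}" by (simp add: star_def)
  next
    fix c assume c: "c \<in> star T2 E2 b - {b}"
    then have "c \<in> T2" "c \<noteq> a" using nab by (auto simp: star_def)
    moreover have "{c, a} \<in> E2" using supp[OF lk_y y ya] c ab calculation by simp
    ultimately show "c \<in> star T2 E2 a - {a}" by (simp add: star_def)
  qed
  define L where "L = star T2 E2 a - {a}"
  have L: "L \<subseteq> T2" by (auto simp: L_def star_def)
  \<comment> \<open>The coefficients are chosen to cancel the coordinate at \<open>a\<close>. At any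
    other vertex \<open>u\<close> outside \<open>L\<close>, the commutation of \<open>x\<close> and
    \<open>y\<close> at the non-edge \<open>{a, u}\<close> makes the same combination
    vanish.\<close>
  define z where "z = x a \<odot>\<^bsub>V2\<^esub> y \<oplus>\<^bsub>V2\<^esub> (\<ominus> y a) \<odot>\<^bsub>V2\<^esub> x"
  define z' where "z' = x a \<odot>\<^bsub>V1\<^esub> e1 w \<oplus>\<^bsub>V1\<^esub> (\<ominus> y a) \<odot>\<^bsub>V1\<^esub> e1 v"
  have coeff: "x a \<in> carrier R" "\<ominus> y a \<in> carrier R" using mem ab by auto
  have z: "z \<in> carrier V2" and z': "z' \<in> carrier V1"
    using coeff x y e1 by (simp_all add: z_def z'_def)
  have zz': "z = \<phi> z'"
    using lin1 coeff e1 by (simp add: linear_map_def z_def z'_def x_def y_def)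
  have "z' w = x a"
    using coeff vw mem ab by (simp add: z'_def free_mod_simps basis_vec_def)
  \<comment> \<open>The nonzero coordinate at \<open>w\<close> will bound the centralizer of
    \<open>z'\<close> by the star of \<open>w\<close>, which is as large as the star of
    \<open>b\<close>.\<close>
  then have z'w: "z' w \<noteq> \<zero>" using xa by (simp add: x_def)
  have zL: "z \<in> supported R T2 L"
    unfolding supported_def
  proof (intro CollectI conjI z ballI)
    fix u assume u: "u \<in> T2 - L"
    have "x a \<otimes> y u = x u \<otimes> y a"
    proof (cases "u = a")
      case False
      then have "{a, u} \<notin> E2" using u by (auto simp: L_def star_def insert_commute)
      then show ?thesis using xy u ab unfolding commutes_def by blast
    qed simp
    then show "z u = \<zero>"
      using u ab mem by (simp add: z_def free_mod_simps l_minus r_minus m_comm r_neg)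
  qed
  \<comment> \<open>A vertex of \<open>L\<close> lies in the links of both \<open>a\<close> and
    \<open>b\<close>, so its basis vector commutes with \<open>x\<close> and \<open>y\<close>. For
    \<open>a\<close> and \<open>b\<close> themselves the star contains \<open>L\<close>, which
    supports \<open>z\<close>.\<close>
  have z_basis: "commutes R T2 E2 z (e2 c)" if "c \<in> L \<union> {a, b}" for c
  proof (cases "c \<in> L")
    case True
    then show ?thesis
      unfolding z_def using lk_x lk_y link L_def coeff x y e2
      by (intro commutes_combination) auto
  next
    case False
    then have c: "c \<in> T2" "L \<subseteq> star T2 E2 c" using that ab link by (auto simp: L_def)
    then have "z \<in> supported R T2 (star T2 E2 c)" using zL by (auto simp: supported_def)
    then show ?thesis
      using commutes_basis_vec_iff[OF graph2 c(1) z] commutes_sym[OF e2 z] by blast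
  qed
  have "supported R T2 (L \<union> {a, b}) \<subseteq> centralizer R T2 E2 z"
  proof
    fix t assume t: "t \<in> supported R T2 (L \<union> {a, b})"
    then have tc: "t \<in> carrier V2" by (simp add: supported_def)
    have "commutes R T2 E2 z t"
      unfolding commutes_def
    proof (intro ballI impI)
      fix u v assume uv: "u \<in> T2" "v \<in> T2" "{u, v} \<notin> E2"
      \<comment> \<open>If both factors were nonzero, \<open>q\<close> would lie in
        \<open>L \<union> {a, b}\<close>, and \<open>z_basis\<close> would make \<open>q\<close>
        adjacent to \<open>p\<close>. So both sides of the required equation are zero at every
        non-edge with distinct ends.\<close>
      have *: "z p \<otimes> t q = \<zero>" if pq: "p \<in> T2" "q \<in> T2" "{p, q} \<notin> E2" "p \<noteq> q" for p q
      proof (cases "t q = \<zero> \<or> z p = \<zero>")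
        case False
        then have "q \<in> L \<union> {a, b}" using t pq by (auto simp: supported_def)
        then have "{q, p} \<in> E2" using supp[OF z_basis z] False pq by blast
        then show ?thesis using pq by (simp add: insert_commute)
      next
        case True
        then show ?thesis using pq free_mod_mem[OF z] free_mod_mem[OF tc] by auto
      qed
      show "z u \<otimes> t v = z v \<otimes> t u"
        using *[of u v] *[of v u] uv by (cases "u = v") (auto simp: insert_commute)
    qed
    then show "t \<in> centralizer R T2 E2 z" using tc by (simp add: centralizer_def)
  qed
  then have "card (supported R T2 (L \<union> {a, b})) \<le> card (centralizer R T2 E2 z)"
    by (rule card_mono[rotated])
      (simp add: centralizer_def finite_free_mod[OF fin(2)])
  also have "\<dots> = card (centralizer R T1 E1 z')" by (simp add: zz' card_centralizer_map[OF z'])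
  also have "\<dots> \<le> card (carrier R) ^ card (star T1 E1 w)"
    by (rule card_centralizer_le[OF fin(1) z' vw(2) z'w])
  \<comment> \<open>The left side is \<open>card L + 2\<close>, while the star of \<open>b\<close>
    has only \<open>card L + 1\<close> elements.\<close>
  finally have "card (L \<union> {a, b}) \<le> card (star T1 E1 w)"
    using card_supported[OF fin(2), of "L \<union> {a, b}"] L ab card_carrier_gt_one by simp
  moreover have "star T2 E2 b = insert b L"
    using ab link by (auto simp: L_def star_def)
  moreover have "a \<notin> insert b L" using ab by (auto simp: L_def)
  moreover have "finite L" using L fin(2) by (rule finite_subset)
  moreover have "L \<union> {a, b} = insert a (insert b L)" by blast
  ultimately show False using card_b by simp
qed

text \<open>Equal sums make \<open>card_star_le\<close> an equality at every matched pair, so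
  \<open>matched_edge\<close> applies and edges go to edges. Thus \<open>f\<close> maps each star
  into a star of the same size, hence onto it, and no edge of the second graph is missed.\<close>

lemma graph_iso: "graph_iso T1 E1 T2 E2"
proof -
  interpret inverse: linear_graph_iso R T2 E2 T1 E1 \<psi> \<phi>
    by unfold_locales
      (use graph1 graph2 lin1 lin2 inv1 inv2 commutes1 commutes2 in auto)
  obtain f where f: "inj_on f T1" "f ` T1 \<subseteq> T2" "\<forall>v\<in>T1. \<phi> (e1 v) (f v) \<noteq> \<zero>"
    using ex_matching by blast
  have eqs: "card T1 = card T2" "(\<Sum>v\<in>T1. card (star T1 E1 v)) = (\<Sum>v\<in>T2. card (star T2 E2 v))"
    using sum_card_star_le inverse.sum_card_star_le by auto
  have f2: "f ` T1 = T2"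
    using card_subset_eq[OF fin(2) f(2)] card_image[OF f(1)] eqs(1) by simp
  have bij: "bij_betw f T1 T2" using f(1) f2 by (simp add: bij_betw_def)
  have "(\<Sum>v\<in>T1. card (star T1 E1 v)) = (\<Sum>v\<in>T1. card (star T2 E2 (f v)))"
    using eqs(2) sum.reindex_bij_betw[OF bij, of "\<lambda>v. card (star T2 E2 v)"] by simp
  then have card_star: "card (star T1 E1 v) = card (star T2 E2 (f v))" if "v \<in> T1" for v
    using sum_mono_inv[of "\<lambda>v. card (star T1 E1 v)" T1 "\<lambda>v. card (star T2 E2 (f v))" v]
      card_star_le f that fin(1) by auto
  have edge: "{f u, f v} \<in> E2" if "u \<in> T1" "v \<in> T1" "{u, v} \<in> E1" for u v
  proof -
    have uv: "u \<noteq> v" using graph1 that(3) by (auto simp: simple_graph_def doubleton_eq_iff)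
    then have "f u \<noteq> f v" using inj_onD[OF f(1), of u v] that by blast
    then show ?thesis
      using matched_edge[OF that(1,2) uv that(3), of "f u" "f v"] f card_star that by blast
  qed
  have star: "f ` star T1 E1 v = star T2 E2 (f v)" if v: "v \<in> T1" for v
  proof (rule card_subset_eq)
    show "finite (star T2 E2 (f v))" using fin(2) by (simp add: star_def)
    show "f ` star T1 E1 v \<subseteq> star T2 E2 (f v)" using v edge f(2) by (auto simp: star_def)
    have "inj_on f (star T1 E1 v)" by (rule inj_on_subset[OF f(1)]) (auto simp: star_def)
    then show "card (f ` star T1 E1 v) = card (star T2 E2 (f v))"
      using card_star[OF v] by (simp add: card_image)
  qed
  have edge': "{u, v} \<in> E1" if uv: "u \<in> T1" "v \<in> T1" "{f u, f v} \<in> E2" for u v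
  proof -
    have "f u \<in> star T2 E2 (f v)" using uv f(2) by (auto simp: star_def)
    then obtain u' where u': "u' \<in> star T1 E1 v" "f u' = f u"
      using star[OF uv(2)] by (metis imageE)
    moreover from u' have "u' \<in> T1" by (simp add: star_def)
    ultimately have "u \<in> star T1 E1 v" using inj_onD[OF f(1), of u' u] uv(1) by simp
    moreover have "u \<noteq> v" using graph2 uv(3) by (auto simp: simple_graph_def doubleton_eq_iff)
    ultimately show ?thesis by (simp add: star_def)
  qed
  show ?thesis
    unfolding graph_iso_def by (intro exI[of _ f] conjI ballI iffI bij) (fact edge, fact edge')
qed

end

section \<open>The graph groups over a prime field\<close>

locale odd_residues = residues_prime +
  assumes odd: "p \<noteq> 2"
begin

sublocale finite_field R
  by unfold_locales simp

lemma two_unit: "\<one> \<oplus> \<one> \<in> Units R"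
  unfolding R_m_def by (rule residue_ring_two_unit[OF p_prime odd])

lemma half_add_half: "inv (\<one> \<oplus> \<one>) \<oplus> inv (\<one> \<oplus> \<one>) = \<one>"
  using two_unit Units_l_inv[OF two_unit] by (simp add: r_distr)

text \<open>Each element of the prime field is a finite sum of ones. This turns closure under
  addition into closure under scalar multiplication.\<close>

lemma residue_induct [consumes 1, case_names zero add_one]:
  assumes "a \<in> carrier R" and "P \<zero>" and "\<And>a. \<lbrakk>a \<in> carrier R; P a\<rbrakk> \<Longrightarrow> P (a \<oplus> \<one>)"
  shows "P a"
proof -
  have "P (int k mod int p)" for k
  proof (induction k)
    case 0
    then show ?case using assms(2) by (simp add: res_zero_eq)
  next
    case (Suc k)
    have "int (Suc k) mod int p = (int k mod int p) \<oplus> \<one>"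
      by (simp add: res_add_eq res_one_eq mod_simps add.commute)
    moreover have "int k mod int p \<in> carrier R" by (simp add: res_carrier_eq prime_gt_0_nat[OF p_prime])
    ultimately show ?case using Suc assms(3) by simp
  qed
  from this[of "nat a"] show ?thesis using assms(1) by (simp add: res_carrier_eq)
qed

text \<open>Over a prime field, multiplication by a scalar is repeated addition. A group
  homomorphism supplies additivity only.\<close>

lemma additive_imp_linear_map:
  assumes M: "module R M" and N: "module R N" and f: "f \<in> carrier M \<rightarrow> carrier N"
    and add: "\<And>x y. \<lbrakk>x \<in> carrier M; y \<in> carrier M\<rbrakk> \<Longrightarrow> f (x \<oplus>\<^bsub>M\<^esub> y) = f x \<oplus>\<^bsub>N\<^esub> f y"
  shows "linear_map R M N f"
proof -
  interpret M: module R M by fact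
  interpret N: module R N by fact
  have fc: "f x \<in> carrier N" if "x \<in> carrier M" for x using f that by blast
  have "f \<zero>\<^bsub>M\<^esub> \<oplus>\<^bsub>N\<^esub> f \<zero>\<^bsub>M\<^esub> = f \<zero>\<^bsub>M\<^esub>" using add[of "\<zero>\<^bsub>M\<^esub>" "\<zero>\<^bsub>M\<^esub>"] by simp
  then have f0: "f \<zero>\<^bsub>M\<^esub> = \<zero>\<^bsub>N\<^esub>" using fc by (metis N.add.l_cancel_one M.zero_closed)
  have "f (a \<odot>\<^bsub>M\<^esub> x) = a \<odot>\<^bsub>N\<^esub> f x" if "a \<in> carrier R" and x: "x \<in> carrier M" for a x
    using that(1) by (induction rule: residue_induct)
      (use x fc f0 in \<open>simp_all add: M.smult_l_distr N.smult_l_distr add\<close>)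
  then show ?thesis using f add by (simp add: linear_map_def)
qed

lemmas wedge_closed' [simp] = wedge_closed[OF is_cring]
lemmas half_closed' [simp] = half_closed[OF is_cring two_unit]

section \<open>The edge subgroup in coordinates and commutation in the quotient\<close>

context
  fixes T :: "'t set" and E :: "'t set set"
begin

private abbreviation (input) V where "V \<equiv> free_mod R T"
private abbreviation (input) W where "W \<equiv> ext_square R T"
private abbreviation (input) M where "M \<equiv> free_nil2_group R T"
private abbreviation (input) J where "J \<equiv> edge_subgroup R T E"
private abbreviation (input) com where "com \<equiv> commutes R T E"

interpretation V: module R V by (rule module_free_mod[OF is_cring])
interpretation W: module R W by (rule module_ext_square[OF is_cring])
interpretation M: group M by (rule group_free_nil2_group[OF is_cring two_unit])
interpretation J: normal J M by (rule edge_subgroup_normal[OF is_cring two_unit])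

lemma mult_central:
  assumes "d \<in> carrier W" "x \<in> carrier V" "w \<in> carrier W"
  shows "(\<zero>\<^bsub>V\<^esub>, d) \<otimes>\<^bsub>M\<^esub> (x, w) = (x, d \<oplus>\<^bsub>W\<^esub> w)"
    and "(x, w) \<otimes>\<^bsub>M\<^esub> (\<zero>\<^bsub>V\<^esub>, d) = (x, w \<oplus>\<^bsub>W\<^esub> d)"
  using assms by (simp_all add: free_nil2_group_simps wedge_zero[OF is_cring])

text \<open>The right side is a subgroup. It contains the generators because the matrix of the wedge
  of two basis vectors \<open>u\<close>, \<open>v\<close> is zero away from the entries
  \<open>(u, v)\<close> and \<open>(v, u)\<close>.\<close>

lemma edge_subgroup_subset:
  "J \<subseteq> {(\<zero>\<^bsub>V\<^esub>, w) |w. w \<in> carrier W \<and> (\<forall>u\<in>T. \<forall>v\<in>T. {u, v} \<notin> E \<longrightarrow> w (u, v) = \<zero>)}" (is "_ \<subseteq> ?K")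
  unfolding edge_subgroup_def
proof (rule M.generate_subgroup_incl)
  show "{(\<zero>\<^bsub>V\<^esub>, wedge R T (basis_vec R T u) (basis_vec R T v)) |u v. {u, v} \<in> E} \<subseteq> ?K"
  proof clarify
    fix u v assume uv: "{u, v} \<in> E"
    have "wedge R T (basis_vec R T u) (basis_vec R T v) \<in> carrier W"
      by (simp add: basis_vec_closed[OF is_cring])
    moreover have "wedge R T (basis_vec R T u) (basis_vec R T v) (a, b) = \<zero>"
      if ab: "a \<in> T" "b \<in> T" "{a, b} \<notin> E" for a b
    proof -
      have "\<not> (a = u \<and> b = v)" "\<not> (a = v \<and> b = u)" using uv ab(3) by (auto simp: insert_commute)
      then show ?thesis using ab by (auto simp: wedge_def basis_vec_def minus_eq)
    qed
    ultimately show "\<exists>w. (\<zero>\<^bsub>V\<^esub>, wedge R T (basis_vec R T u) (basis_vec R T v)) = (\<zero>\<^bsub>V\<^esub>, w) \<and>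
        w \<in> carrier W \<and> (\<forall>u\<in>T. \<forall>v\<in>T. {u, v} \<notin> E \<longrightarrow> w (u, v) = \<zero>)"
      by blast
  qed
  show "subgroup ?K M"
  proof (rule M.subgroupI)
    show "?K \<subseteq> carrier M" by (auto simp: free_nil2_group_simps)
    have "\<zero>\<^bsub>W\<^esub> (u, v) = \<zero>" if "u \<in> T" "v \<in> T" for u v
      using that by (simp add: ext_square_simps(2))
    then have "(\<zero>\<^bsub>V\<^esub>, \<zero>\<^bsub>W\<^esub>) \<in> ?K" using W.zero_closed by blast
    then show "?K \<noteq> {}" by blast
    fix g assume "g \<in> ?K"
    then obtain w where w: "g = (\<zero>\<^bsub>V\<^esub>, w)" "w \<in> carrier W"
      "\<And>u v. \<lbrakk>u \<in> T; v \<in> T; {u, v} \<notin> E\<rbrakk> \<Longrightarrow> w (u, v) = \<zero>" by blast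
    \<comment> \<open>Scalar multiplication is defined entrywise, so this form gives access to the
      entries of the inverse.\<close>
    have neg: "\<ominus>\<^bsub>W\<^esub> w = (\<ominus> \<one>) \<odot>\<^bsub>W\<^esub> w" using w by (simp add: W.smult_l_minus)
    have "inv\<^bsub>M\<^esub> g = (\<zero>\<^bsub>V\<^esub>, \<ominus>\<^bsub>W\<^esub> w)"
      using w mult_central[of "\<ominus>\<^bsub>W\<^esub> w" "\<zero>\<^bsub>V\<^esub>" w]
      by (intro M.inv_equality) (auto simp: free_nil2_group_simps(1,3) W.l_neg)
    moreover have "(\<ominus>\<^bsub>W\<^esub> w) (u, v) = \<zero>" if "u \<in> T" "v \<in> T" "{u, v} \<notin> E" for u v
      unfolding neg using w(3)[OF that] that by (simp add: ext_square_simps(4))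
    ultimately show "inv\<^bsub>M\<^esub> g \<in> ?K" using w(2) by blast
    fix g' assume "g' \<in> ?K"
    then obtain w' where w': "g' = (\<zero>\<^bsub>V\<^esub>, w')" "w' \<in> carrier W"
      "\<And>u v. \<lbrakk>u \<in> T; v \<in> T; {u, v} \<notin> E\<rbrakk> \<Longrightarrow> w' (u, v) = \<zero>" by blast
    have "(w \<oplus>\<^bsub>W\<^esub> w') (u, v) = \<zero>" if "u \<in> T" "v \<in> T" "{u, v} \<notin> E" for u v
      using w(3)[OF that] w'(3)[OF that] that by (simp add: ext_square_simps(3))
    then show "g \<otimes>\<^bsub>M\<^esub> g' \<in> ?K"
      using w(1,2) w'(1,2) mult_central(1)[of w "\<zero>\<^bsub>V\<^esub>" w'] by simp
  qed
qed

lemma mem_edge_subgroupI: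
  assumes T: "finite T" and w: "w \<in> carrier W" and zero: "\<And>u v. \<lbrakk>u \<in> T; v \<in> T; {u, v} \<notin> E\<rbrakk> \<Longrightarrow> w (u, v) = \<zero>"
  shows "(\<zero>\<^bsub>V\<^esub>, w) \<in> J"
proof -
  define H where "H = {w \<in> carrier W. (\<zero>\<^bsub>V\<^esub>, w) \<in> J}"
  have H0: "\<zero>\<^bsub>W\<^esub> \<in> H" using J.one_closed by (simp add: H_def free_nil2_group_simps(3))
  have Hadd: "w \<oplus>\<^bsub>W\<^esub> w' \<in> H" if "w \<in> H" "w' \<in> H" for w w'
  proof -
    have "(\<zero>\<^bsub>V\<^esub>, w) \<otimes>\<^bsub>M\<^esub> (\<zero>\<^bsub>V\<^esub>, w') = (\<zero>\<^bsub>V\<^esub>, w \<oplus>\<^bsub>W\<^esub> w')"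
      using that by (intro mult_central(1)) (auto simp: H_def)
    then show ?thesis
      using J.m_closed[of "(\<zero>\<^bsub>V\<^esub>, w)" "(\<zero>\<^bsub>V\<^esub>, w')"] that by (simp add: H_def)
  qed
  have HW: "w \<in> carrier W" if "w \<in> H" for w using that by (simp add: H_def)
  have Hsmult: "a \<odot>\<^bsub>W\<^esub> w \<in> H" if "a \<in> carrier R" and w: "w \<in> H" for a w
    using that(1) by (induction rule: residue_induct)
      (use w HW H0 Hadd in \<open>simp_all add: W.smult_l_distr\<close>)
  have Hsum: "(\<Oplus>\<^bsub>W\<^esub>i\<in>A. g i) \<in> H" if "finite A" "\<And>i. i \<in> A \<Longrightarrow> g i \<in> H" for A :: "'t set" and g
    using that
  proof (induction A)
    case empty
    then show ?case using H0 by simp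
  next
    case (insert i A)
    moreover have "g \<in> A \<rightarrow> carrier W" "g i \<in> carrier W" using insert.prems by (auto simp: H_def)
    ultimately show ?case using Hadd by simp
  qed
  let ?e = "\<lambda>u v. wedge R T (basis_vec R T u) (basis_vec R T v)"
  have e: "?e u v \<in> carrier W" for u v by (simp add: basis_vec_closed[OF is_cring])
  have "w (u, v) \<odot>\<^bsub>W\<^esub> ?e u v \<in> H" if uv: "u \<in> T" "v \<in> T" for u v
  proof (cases "{u, v} \<in> E")
    case True
    then have "(\<zero>\<^bsub>V\<^esub>, ?e u v) \<in> J" unfolding edge_subgroup_def by (intro generate.incl) blast
    then show ?thesis using e ext_square_mem(2)[OF w uv] by (intro Hsmult) (auto simp: H_def)
  next
    case False
    then show ?thesis using zero[OF uv] e H0 by simp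
  qed
  then have "(\<Oplus>\<^bsub>W\<^esub>u\<in>T. \<Oplus>\<^bsub>W\<^esub>v\<in>T. w (u, v) \<odot>\<^bsub>W\<^esub> ?e u v) \<in> H"
    by (intro Hsum[OF T])
  then have "inv (\<one> \<oplus> \<one>) \<odot>\<^bsub>W\<^esub> (\<Oplus>\<^bsub>W\<^esub>u\<in>T. \<Oplus>\<^bsub>W\<^esub>v\<in>T. w (u, v) \<odot>\<^bsub>W\<^esub> ?e u v) \<in> H"
    by (rule Hsmult[OF half_closed'])
  then have "w \<in> H" using ext_square_expansion[OF is_cring T two_unit w] by simp
  then show ?thesis by (simp add: H_def)
qed

lemma mem_edge_subgroup_iff:
  assumes "finite T"
  shows "(x, w) \<in> J \<longleftrightarrow> x = \<zero>\<^bsub>V\<^esub> \<and> w \<in> carrier W \<and> (\<forall>u\<in>T. \<forall>v\<in>T. {u, v} \<notin> E \<longrightarrow> w (u, v) = \<zero>)"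
  by (auto intro: mem_edge_subgroupI[OF assms] dest: subsetD[OF edge_subgroup_subset])

text \<open>The two products contain one half of \<open>wedge R T x y\<close> with opposite signs,
  so they differ by the full wedge, which is therefore the commutator.\<close>

lemma mult_commutator:
  assumes x: "x \<in> carrier V" "y \<in> carrier V" and w: "w \<in> carrier W" "w' \<in> carrier W"
  shows "(x, w) \<otimes>\<^bsub>M\<^esub> (y, w') = (\<zero>\<^bsub>V\<^esub>, wedge R T x y) \<otimes>\<^bsub>M\<^esub> ((y, w') \<otimes>\<^bsub>M\<^esub> (x, w))"
proof -
  let ?h = "inv (\<one> \<oplus> \<one>)" and ?d = "wedge R T x y"
  have d: "?d \<in> carrier W" using x by simp
  have hd: "?h \<odot>\<^bsub>W\<^esub> ?d \<in> carrier W" using d by simp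
  have "?d = ?h \<odot>\<^bsub>W\<^esub> ?d \<oplus>\<^bsub>W\<^esub> ?h \<odot>\<^bsub>W\<^esub> ?d"
    using d by (simp add: W.smult_l_distr[symmetric] half_add_half)
  then have "?d \<oplus>\<^bsub>W\<^esub> \<ominus>\<^bsub>W\<^esub> (?h \<odot>\<^bsub>W\<^esub> ?d) = ?h \<odot>\<^bsub>W\<^esub> ?d"
    using hd by (metis W.a_assoc W.r_neg W.r_zero W.a_inv_closed)
  then have "w \<oplus>\<^bsub>W\<^esub> w' \<oplus>\<^bsub>W\<^esub> ?h \<odot>\<^bsub>W\<^esub> ?d =
      ?d \<oplus>\<^bsub>W\<^esub> (w' \<oplus>\<^bsub>W\<^esub> w \<oplus>\<^bsub>W\<^esub> \<ominus>\<^bsub>W\<^esub> (?h \<odot>\<^bsub>W\<^esub> ?d))"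
    using d hd w by (metis W.a_comm W.a_assoc W.a_closed W.a_inv_closed)
  then show ?thesis
    using x w d hd mult_central(1)[of ?d "y \<oplus>\<^bsub>V\<^esub> x" "w' \<oplus>\<^bsub>W\<^esub> w \<oplus>\<^bsub>W\<^esub> ?h \<odot>\<^bsub>W\<^esub> wedge R T y x"]
    by (simp add: free_nil2_group_simps(2) wedge_swap[OF is_cring, of x T y] W.smult_r_minus V.a_comm)
qed

lemma cosets_commute_iff:
  assumes T: "finite T" and x: "x \<in> carrier V" "y \<in> carrier V" and w: "w \<in> carrier W" "w' \<in> carrier W"
  shows "(J #>\<^bsub>M\<^esub> (x, w)) \<otimes>\<^bsub>M Mod J\<^esub> (J #>\<^bsub>M\<^esub> (y, w')) =
      (J #>\<^bsub>M\<^esub> (y, w')) \<otimes>\<^bsub>M Mod J\<^esub> (J #>\<^bsub>M\<^esub> (x, w)) \<longleftrightarrow> com x y"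
proof -
  have c: "(x, w) \<in> carrier M" "(y, w') \<in> carrier M"
    using x w by (auto simp: free_nil2_group_simps(1))
  let ?g = "(y, w') \<otimes>\<^bsub>M\<^esub> (x, w)" and ?d = "(\<zero>\<^bsub>V\<^esub>, wedge R T x y)"
  have g: "?g \<in> carrier M" using c by simp
  have d: "?d \<in> carrier M" using x by (simp add: free_nil2_group_simps(1))
  have "J #>\<^bsub>M\<^esub> (?d \<otimes>\<^bsub>M\<^esub> ?g) = J #>\<^bsub>M\<^esub> ?g \<longleftrightarrow> ?d \<in> J"
  proof
    assume "J #>\<^bsub>M\<^esub> (?d \<otimes>\<^bsub>M\<^esub> ?g) = J #>\<^bsub>M\<^esub> ?g"
    then have "?d \<otimes>\<^bsub>M\<^esub> ?g \<in> J #>\<^bsub>M\<^esub> ?g"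
      using M.rcos_self[OF M.m_closed[OF d g] J.subgroup_axioms] by simp
    then obtain j where "j \<in> J" "?d \<otimes>\<^bsub>M\<^esub> ?g = j \<otimes>\<^bsub>M\<^esub> ?g" by (auto simp: r_coset_def)
    then show "?d \<in> J" using d g J.mem_carrier M.right_cancel by metis
  next
    assume "?d \<in> J"
    then show "J #>\<^bsub>M\<^esub> (?d \<otimes>\<^bsub>M\<^esub> ?g) = J #>\<^bsub>M\<^esub> ?g"
      using M.coset_mult_assoc[OF J.subset d g] M.coset_join2[OF d J.subgroup_axioms] by simp
  qed
  also have "?d \<in> J \<longleftrightarrow> com x y"
  proof -
    have "wedge R T x y (u, v) = \<zero> \<longleftrightarrow> x u \<otimes> y v = x v \<otimes> y u" if "u \<in> T" "v \<in> T" for u v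
      using that free_mod_mem[OF x(1)] free_mod_mem[OF x(2)] by (simp add: wedge_def)
    then show ?thesis unfolding mem_edge_subgroup_iff[OF T] commutes_def using wedge_closed'[OF x] by blast
  qed
  finally show ?thesis
    using c mult_commutator[OF x w] by (simp add: FactGroup_def J.rcos_sum)
qed

text \<open>Elements of \<open>J\<close> have zero \<open>V\<close> component, so the projection to
  \<open>V\<close> is well defined on cosets.\<close>

lemma fst_image_coset:
  assumes "x \<in> carrier V" "w \<in> carrier W"
  shows "fst ` (J #>\<^bsub>M\<^esub> (x, w)) = {x}"
proof -
  have "fst (j \<otimes>\<^bsub>M\<^esub> (x, w)) = x" if j: "j \<in> J" for j
  proof -
    obtain v where "j = (\<zero>\<^bsub>V\<^esub>, v)" "v \<in> carrier W" using subsetD[OF edge_subgroup_subset j] by blast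
    then show ?thesis using assms by (simp add: mult_central)
  qed
  then have "(\<lambda>j. fst (j \<otimes>\<^bsub>M\<^esub> (x, w))) ` J = (\<lambda>j. x) ` J" by (rule image_cong[OF refl])
  moreover have "J #>\<^bsub>M\<^esub> (x, w) = (\<lambda>j. j \<otimes>\<^bsub>M\<^esub> (x, w)) ` J" by (auto simp: r_coset_def)
  moreover have "J \<noteq> {}" using J.one_closed by blast
  ultimately show ?thesis by (simp only: image_image image_constant_conv if_False)
qed

end

section \<open>From group isomorphisms to graph isomorphisms\<close>

text \<open>Elements of \<open>\<and>\<^sup>2 V\<close> do not contribute to the \<open>V\<close> component of the image: by the universal
  property \<open>\<and>\<^sup>2 V\<close> is generated by commutators, and \<open>V\<close> is abelian.\<close>

lemma hom_induces_linear_map: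
  fixes T1 :: "'t1 set" and T2 :: "'t2 set"
  assumes T1: "finite T1"
    and \<Phi>: "\<Phi> \<in> hom (free_nil2_group R T1 Mod edge_subgroup R T1 E1)
      (free_nil2_group R T2 Mod edge_subgroup R T2 E2)"
  obtains \<phi> where "linear_map R (free_mod R T1) (free_mod R T2) \<phi>"
    and "\<And>x w. \<lbrakk>x \<in> carrier (free_mod R T1); w \<in> carrier (ext_square R T1)\<rbrakk> \<Longrightarrow>
      \<exists>w'\<in>carrier (ext_square R T2).
        \<Phi> (edge_subgroup R T1 E1 #>\<^bsub>free_nil2_group R T1\<^esub> (x, w)) =
        edge_subgroup R T2 E2 #>\<^bsub>free_nil2_group R T2\<^esub> (\<phi> x, w')"
proof -
  let ?V1 = "free_mod R T1" and ?V2 = "free_mod R T2"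
    and ?W1 = "ext_square R T1" and ?W2 = "ext_square R T2"
    and ?M1 = "free_nil2_group R T1" and ?M2 = "free_nil2_group R T2"
    and ?J1 = "edge_subgroup R T1 E1" and ?J2 = "edge_subgroup R T2 E2"
  interpret V1: module R ?V1 by (rule module_free_mod[OF is_cring])
  interpret W1: module R ?W1 by (rule module_ext_square[OF is_cring])
  interpret V2: module R ?V2 by (rule module_free_mod[OF is_cring])
  interpret W2: module R ?W2 by (rule module_ext_square[OF is_cring])
  interpret M1: group ?M1 by (rule group_free_nil2_group[OF is_cring two_unit])
  interpret M2: group ?M2 by (rule group_free_nil2_group[OF is_cring two_unit])
  interpret J1: normal ?J1 ?M1 by (rule edge_subgroup_normal[OF is_cring two_unit])
  interpret J2: normal ?J2 ?M2 by (rule edge_subgroup_normal[OF is_cring two_unit])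
  define \<Theta> where "\<Theta> g = \<Phi> (?J1 #>\<^bsub>?M1\<^esub> g)" for g
  have "\<Theta> = \<Phi> \<circ> (\<lambda>g. ?J1 #>\<^bsub>?M1\<^esub> g)" by (simp add: \<Theta>_def fun_eq_iff)
  then have "\<Theta> \<in> hom ?M1 (?M2 Mod ?J2)"
    using hom_compose[OF J1.r_coset_hom_Mod \<Phi>] by simp
  then have \<Theta>_mult: "\<Theta> (g \<otimes>\<^bsub>?M1\<^esub> h) = \<Theta> g <#>\<^bsub>?M2\<^esub> \<Theta> h"
    and \<Theta>_closed: "\<Theta> g \<in> rcosets\<^bsub>?M2\<^esub> ?J2"
    if "g \<in> carrier ?M1" "h \<in> carrier ?M1" for g h
    using that by (auto simp: hom_def FactGroup_def)
  \<comment> \<open>The \<open>V\<close> component of the image coset, on which \<open>fst\<close>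
    takes a single value.\<close>
  define \<theta> where "\<theta> g = the_elem (fst ` \<Theta> g)" for g
  have \<theta>: "\<theta> g \<in> carrier ?V2 \<and> (\<exists>w'\<in>carrier ?W2. \<Theta> g = ?J2 #>\<^bsub>?M2\<^esub> (\<theta> g, w'))"
    if g: "g \<in> carrier ?M1" for g
  proof -
    obtain y w' where "\<Theta> g = ?J2 #>\<^bsub>?M2\<^esub> (y, w')" "y \<in> carrier ?V2" "w' \<in> carrier ?W2"
      using \<Theta>_closed[OF g g] by (auto simp: RCOSETS_def free_nil2_group_simps(1))
    moreover from this have "\<theta> g = y" by (simp add: \<theta>_def fst_image_coset)
    ultimately show ?thesis by blast
  qed
  have \<theta>_mult: "\<theta> (g \<otimes>\<^bsub>?M1\<^esub> h) = \<theta> g \<oplus>\<^bsub>?V2\<^esub> \<theta> h" if g: "g \<in> carrier ?M1" and h: "h \<in> carrier ?M1" for g h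
  proof -
    obtain w w' where w: "w \<in> carrier ?W2" "\<Theta> g = ?J2 #>\<^bsub>?M2\<^esub> (\<theta> g, w)"
      and w': "w' \<in> carrier ?W2" "\<Theta> h = ?J2 #>\<^bsub>?M2\<^esub> (\<theta> h, w')"
      using \<theta>[OF g] \<theta>[OF h] by blast
    have v: "\<theta> g \<in> carrier ?V2" "\<theta> h \<in> carrier ?V2" using \<theta> g h by blast+
    have c: "(\<theta> g, w) \<in> carrier ?M2" "(\<theta> h, w') \<in> carrier ?M2"
      using v w(1) w'(1) by (simp_all add: free_nil2_group_simps(1))
    have "\<Theta> (g \<otimes>\<^bsub>?M1\<^esub> h) = ?J2 #>\<^bsub>?M2\<^esub> ((\<theta> g, w) \<otimes>\<^bsub>?M2\<^esub> (\<theta> h, w'))"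
      unfolding \<Theta>_mult[OF g h] w(2) w'(2) by (rule J2.rcos_sum[OF c])
    then show ?thesis
      using M2.m_closed[OF c]
      by (simp add: \<theta>_def[of "g \<otimes>\<^bsub>?M1\<^esub> h"] free_nil2_group_simps(1,2) fst_image_coset)
  qed
  have M1: "(x, w) \<in> carrier ?M1" if "x \<in> carrier ?V1" "w \<in> carrier ?W1" for x w
    using that by (simp add: free_nil2_group_simps(1))
  have \<theta>V: "\<theta> (x, w) \<in> carrier ?V2" if "x \<in> carrier ?V1" "w \<in> carrier ?W1" for x w
    using \<theta> M1 that by blast
  have \<theta>_central: "\<theta> (x, d \<oplus>\<^bsub>?W1\<^esub> w) = \<theta> (\<zero>\<^bsub>?V1\<^esub>, d) \<oplus>\<^bsub>?V2\<^esub> \<theta> (x, w)"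
    if "x \<in> carrier ?V1" "d \<in> carrier ?W1" "w \<in> carrier ?W1" for x d w
    using \<theta>_mult[of "(\<zero>\<^bsub>?V1\<^esub>, d)" "(x, w)"] mult_central(1)[of d _ x w] M1 that by simp
  have lin: "linear_map R ?W1 ?V2 (\<lambda>w. \<theta> (\<zero>\<^bsub>?V1\<^esub>, w))"
    by (rule additive_imp_linear_map[OF W1.module_axioms V2.module_axioms])
      (simp_all add: \<theta>V \<theta>_central)
  have lin0: "linear_map R ?W1 ?V2 (\<lambda>w. \<zero>\<^bsub>?V2\<^esub>)"
    by (rule additive_imp_linear_map[OF W1.module_axioms V2.module_axioms]) simp_all
  have wedge0: "\<theta> (\<zero>\<^bsub>?V1\<^esub>, wedge R T1 x y) = \<zero>\<^bsub>?V2\<^esub>"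
    if xy: "x \<in> carrier ?V1" "y \<in> carrier ?V1" for x y
  proof -
    let ?x = "(x, \<zero>\<^bsub>?W1\<^esub>)" and ?y = "(y, \<zero>\<^bsub>?W1\<^esub>)"
    have c: "?x \<in> carrier ?M1" "?y \<in> carrier ?M1" using xy M1 by simp_all
    have d: "(\<zero>\<^bsub>?V1\<^esub>, wedge R T1 x y) \<in> carrier ?M1" using xy M1 by simp
    have v: "\<theta> ?x \<in> carrier ?V2" "\<theta> ?y \<in> carrier ?V2" using \<theta> c by blast+
    have "\<theta> ?x \<oplus>\<^bsub>?V2\<^esub> \<theta> ?y = \<theta> (\<zero>\<^bsub>?V1\<^esub>, wedge R T1 x y) \<oplus>\<^bsub>?V2\<^esub> (\<theta> ?y \<oplus>\<^bsub>?V2\<^esub> \<theta> ?x)"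
      using mult_commutator[OF xy W1.zero_closed W1.zero_closed] c d \<theta>_mult by (metis M1.m_closed)
    then have "\<theta> ?y \<oplus>\<^bsub>?V2\<^esub> \<theta> ?x = \<theta> (\<zero>\<^bsub>?V1\<^esub>, wedge R T1 x y) \<oplus>\<^bsub>?V2\<^esub> (\<theta> ?y \<oplus>\<^bsub>?V2\<^esub> \<theta> ?x)"
      using v by (simp add: V2.a_comm)
    then show ?thesis using v \<theta> d by (metis V2.add.r_cancel_one' V2.a_closed)
  qed
  \<comment> \<open>Both \<open>\<theta>\<close> on the central part and the zero map are linear,
    and they agree on wedges.\<close>
  have \<theta>0: "\<theta> (\<zero>\<^bsub>?V1\<^esub>, w) = \<zero>\<^bsub>?V2\<^esub>" if "w \<in> carrier ?W1" for w
    by (rule ext_square_unique[OF is_cring T1 two_unit V2.module_axioms lin lin0 wedge0 that])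
  have \<theta>_eq: "\<theta> (x, w) = \<theta> (x, \<zero>\<^bsub>?W1\<^esub>)" if "x \<in> carrier ?V1" "w \<in> carrier ?W1" for x w
    using \<theta>_central[of x w "\<zero>\<^bsub>?W1\<^esub>"] \<theta>0 \<theta>V that by simp
  show ?thesis
  proof
    show "linear_map R ?V1 ?V2 (\<lambda>x. \<theta> (x, \<zero>\<^bsub>?W1\<^esub>))"
    proof (rule additive_imp_linear_map[OF V1.module_axioms V2.module_axioms])
      fix x y assume xy: "x \<in> carrier ?V1" "y \<in> carrier ?V1"
      let ?d = "\<zero>\<^bsub>?W1\<^esub> \<oplus>\<^bsub>?W1\<^esub> \<zero>\<^bsub>?W1\<^esub> \<oplus>\<^bsub>?W1\<^esub> inv (\<one> \<oplus> \<one>) \<odot>\<^bsub>?W1\<^esub> wedge R T1 x y"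
      have "\<theta> (x, \<zero>\<^bsub>?W1\<^esub>) \<oplus>\<^bsub>?V2\<^esub> \<theta> (y, \<zero>\<^bsub>?W1\<^esub>) = \<theta> (x \<oplus>\<^bsub>?V1\<^esub> y, ?d)"
        using \<theta>_mult[OF M1 M1, of x "\<zero>\<^bsub>?W1\<^esub>" y "\<zero>\<^bsub>?W1\<^esub>"] xy by (simp add: free_nil2_group_simps(2))
      then show "\<theta> (x \<oplus>\<^bsub>?V1\<^esub> y, \<zero>\<^bsub>?W1\<^esub>) = \<theta> (x, \<zero>\<^bsub>?W1\<^esub>) \<oplus>\<^bsub>?V2\<^esub> \<theta> (y, \<zero>\<^bsub>?W1\<^esub>)"
        using \<theta>_eq[of "x \<oplus>\<^bsub>?V1\<^esub> y" ?d] xy by simp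
    qed (simp add: \<theta>V)
    fix x w assume xw: "x \<in> carrier ?V1" "w \<in> carrier ?W1"
    show "\<exists>w'\<in>carrier ?W2. \<Phi> (?J1 #>\<^bsub>?M1\<^esub> (x, w)) = ?J2 #>\<^bsub>?M2\<^esub> (\<theta> (x, \<zero>\<^bsub>?W1\<^esub>), w')"
      using conjunct2[OF \<theta>[OF M1[OF xw]]] unfolding \<theta>_eq[OF xw] \<Theta>_def .
  qed
qed

text \<open>The linear maps induced by the isomorphism and by its inverse satisfy the assumptions of
  \<open>linear_graph_iso\<close>: they are mutually inverse because \<open>V\<close> components can
  be read off cosets, and they preserve \<open>commutes\<close> because it expresses commutation of
  cosets.\<close>

lemma iso_imp_graph_iso:
  fixes T1 :: "'t1 set" and T2 :: "'t2 set"
  assumes graph1: "simple_graph T1 E1" and graph2: "simple_graph T2 E2"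
    and iso: "free_nil2_group R T1 Mod edge_subgroup R T1 E1 \<cong>
      free_nil2_group R T2 Mod edge_subgroup R T2 E2"
  shows "graph_iso T1 E1 T2 E2"
proof -
  let ?V1 = "free_mod R T1" and ?V2 = "free_mod R T2"
    and ?W1 = "ext_square R T1" and ?W2 = "ext_square R T2"
    and ?M1 = "free_nil2_group R T1" and ?M2 = "free_nil2_group R T2"
    and ?J1 = "edge_subgroup R T1 E1" and ?J2 = "edge_subgroup R T2 E2"
  interpret V1: module R ?V1 by (rule module_free_mod[OF is_cring])
  interpret W1: module R ?W1 by (rule module_ext_square[OF is_cring])
  interpret V2: module R ?V2 by (rule module_free_mod[OF is_cring])
  interpret W2: module R ?W2 by (rule module_ext_square[OF is_cring])
  interpret J1: normal ?J1 ?M1 by (rule edge_subgroup_normal[OF is_cring two_unit])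
  interpret J2: normal ?J2 ?M2 by (rule edge_subgroup_normal[OF is_cring two_unit])
  have T1: "finite T1" and T2: "finite T2" using graph1 graph2 by (simp_all add: simple_graph_def)
  obtain \<Phi> where \<Phi>: "\<Phi> \<in> iso (?M1 Mod ?J1) (?M2 Mod ?J2)" using iso by (auto simp: is_iso_def)
  define \<Psi> where "\<Psi> = inv_into (carrier (?M1 Mod ?J1)) \<Phi>"
  have \<Psi>: "\<Psi> \<in> iso (?M2 Mod ?J2) (?M1 Mod ?J1)"
    unfolding \<Psi>_def by (rule group.iso_set_sym[OF J1.factorgroup_is_group \<Phi>])
  have bij: "bij_betw \<Phi> (carrier (?M1 Mod ?J1)) (carrier (?M2 Mod ?J2))"
    and \<Phi>h: "\<Phi> \<in> hom (?M1 Mod ?J1) (?M2 Mod ?J2)" and \<Psi>h: "\<Psi> \<in> hom (?M2 Mod ?J2) (?M1 Mod ?J1)"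
    using \<Phi> \<Psi> by (auto simp: iso_def)
  obtain \<phi> where \<phi>: "linear_map R ?V1 ?V2 \<phi>"
    "\<And>x w. \<lbrakk>x \<in> carrier ?V1; w \<in> carrier ?W1\<rbrakk> \<Longrightarrow>
      \<exists>w'\<in>carrier ?W2. \<Phi> (?J1 #>\<^bsub>?M1\<^esub> (x, w)) = ?J2 #>\<^bsub>?M2\<^esub> (\<phi> x, w')"
    by (rule hom_induces_linear_map[OF T1 \<Phi>h]) blast
  obtain \<psi> where \<psi>: "linear_map R ?V2 ?V1 \<psi>"
    "\<And>x w. \<lbrakk>x \<in> carrier ?V2; w \<in> carrier ?W2\<rbrakk> \<Longrightarrow>
      \<exists>w'\<in>carrier ?W1. \<Psi> (?J2 #>\<^bsub>?M2\<^esub> (x, w)) = ?J1 #>\<^bsub>?M1\<^esub> (\<psi> x, w')"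
    by (rule hom_induces_linear_map[OF T2 \<Psi>h]) blast
  have \<phi>c: "\<phi> x \<in> carrier ?V2" if "x \<in> carrier ?V1" for x using \<phi>(1) that by (auto simp: linear_map_def)
  have \<psi>c: "\<psi> x \<in> carrier ?V1" if "x \<in> carrier ?V2" for x using \<psi>(1) that by (auto simp: linear_map_def)
  have coset1: "?J1 #>\<^bsub>?M1\<^esub> (x, w) \<in> carrier (?M1 Mod ?J1)"
    if "x \<in> carrier ?V1" "w \<in> carrier ?W1" for x w
    using that by (auto simp: FactGroup_def RCOSETS_def free_nil2_group_simps(1))
  have coset2: "?J2 #>\<^bsub>?M2\<^esub> (x, w) \<in> carrier (?M2 Mod ?J2)"
    if "x \<in> carrier ?V2" "w \<in> carrier ?W2" for x w
    using that by (auto simp: FactGroup_def RCOSETS_def free_nil2_group_simps(1))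
  have \<Psi>\<Phi>: "\<Psi> (\<Phi> X) = X" if "X \<in> carrier (?M1 Mod ?J1)" for X
    unfolding \<Psi>_def using bij that by (rule bij_betw_inv_into_left)
  have \<Phi>\<Psi>: "\<Phi> (\<Psi> Y) = Y" if "Y \<in> carrier (?M2 Mod ?J2)" for Y
    unfolding \<Psi>_def using bij that by (rule bij_betw_inv_into_right)
  interpret linear_graph_iso R T1 E1 T2 E2 \<phi> \<psi>
  proof unfold_locales
    fix x assume x: "x \<in> carrier ?V1"
    obtain w' where w': "w' \<in> carrier ?W2" "\<Phi> (?J1 #>\<^bsub>?M1\<^esub> (x, \<zero>\<^bsub>?W1\<^esub>)) = ?J2 #>\<^bsub>?M2\<^esub> (\<phi> x, w')"
      using \<phi>(2)[OF x W1.zero_closed] by blast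
    obtain w'' where w'': "w'' \<in> carrier ?W1" "\<Psi> (?J2 #>\<^bsub>?M2\<^esub> (\<phi> x, w')) = ?J1 #>\<^bsub>?M1\<^esub> (\<psi> (\<phi> x), w'')"
      using \<psi>(2)[OF \<phi>c[OF x] w'(1)] by blast
    have "?J1 #>\<^bsub>?M1\<^esub> (x, \<zero>\<^bsub>?W1\<^esub>) = ?J1 #>\<^bsub>?M1\<^esub> (\<psi> (\<phi> x), w'')"
      using \<Psi>\<Phi>[OF coset1[OF x W1.zero_closed]] w'(2) w''(2) by simp
    then show "\<psi> (\<phi> x) = x"
      using fst_image_coset[OF x W1.zero_closed, of E1]
        fst_image_coset[OF \<psi>c[OF \<phi>c[OF x]] w''(1), of E1] by simp
    fix x' assume x': "x' \<in> carrier ?V1" and "commutes R T1 E1 x x'"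
    then have comm: "(?J1 #>\<^bsub>?M1\<^esub> (x, \<zero>\<^bsub>?W1\<^esub>)) \<otimes>\<^bsub>?M1 Mod ?J1\<^esub> (?J1 #>\<^bsub>?M1\<^esub> (x', \<zero>\<^bsub>?W1\<^esub>)) =
      (?J1 #>\<^bsub>?M1\<^esub> (x', \<zero>\<^bsub>?W1\<^esub>)) \<otimes>\<^bsub>?M1 Mod ?J1\<^esub> (?J1 #>\<^bsub>?M1\<^esub> (x, \<zero>\<^bsub>?W1\<^esub>))"
      using cosets_commute_iff[OF T1 x x' W1.zero_closed W1.zero_closed] by simp
    obtain v where v: "v \<in> carrier ?W2" "\<Phi> (?J1 #>\<^bsub>?M1\<^esub> (x', \<zero>\<^bsub>?W1\<^esub>)) = ?J2 #>\<^bsub>?M2\<^esub> (\<phi> x', v)"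
      using \<phi>(2)[OF x' W1.zero_closed] by blast
    show "commutes R T2 E2 (\<phi> x) (\<phi> x')"
      using arg_cong[OF comm, of \<Phi>] hom_mult[OF \<Phi>h coset1 coset1] x x' v w'
        cosets_commute_iff[OF T2 \<phi>c[OF x] \<phi>c[OF x'] w'(1) v(1)] by simp
  next
    fix y assume y: "y \<in> carrier ?V2"
    obtain w' where w': "w' \<in> carrier ?W1" "\<Psi> (?J2 #>\<^bsub>?M2\<^esub> (y, \<zero>\<^bsub>?W2\<^esub>)) = ?J1 #>\<^bsub>?M1\<^esub> (\<psi> y, w')"
      using \<psi>(2)[OF y W2.zero_closed] by blast
    obtain w'' where w'': "w'' \<in> carrier ?W2" "\<Phi> (?J1 #>\<^bsub>?M1\<^esub> (\<psi> y, w')) = ?J2 #>\<^bsub>?M2\<^esub> (\<phi> (\<psi> y), w'')"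
      using \<phi>(2)[OF \<psi>c[OF y] w'(1)] by blast
    have "?J2 #>\<^bsub>?M2\<^esub> (y, \<zero>\<^bsub>?W2\<^esub>) = ?J2 #>\<^bsub>?M2\<^esub> (\<phi> (\<psi> y), w'')"
      using \<Phi>\<Psi>[OF coset2[OF y W2.zero_closed]] w'(2) w''(2) by simp
    then show "\<phi> (\<psi> y) = y"
      using fst_image_coset[OF y W2.zero_closed, of E2]
        fst_image_coset[OF \<phi>c[OF \<psi>c[OF y]] w''(1), of E2] by simp
    fix y' assume y': "y' \<in> carrier ?V2" and "commutes R T2 E2 y y'"
    then have comm: "(?J2 #>\<^bsub>?M2\<^esub> (y, \<zero>\<^bsub>?W2\<^esub>)) \<otimes>\<^bsub>?M2 Mod ?J2\<^esub> (?J2 #>\<^bsub>?M2\<^esub> (y', \<zero>\<^bsub>?W2\<^esub>)) =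
      (?J2 #>\<^bsub>?M2\<^esub> (y', \<zero>\<^bsub>?W2\<^esub>)) \<otimes>\<^bsub>?M2 Mod ?J2\<^esub> (?J2 #>\<^bsub>?M2\<^esub> (y, \<zero>\<^bsub>?W2\<^esub>))"
      using cosets_commute_iff[OF T2 y y' W2.zero_closed W2.zero_closed] by simp
    obtain v where v: "v \<in> carrier ?W1" "\<Psi> (?J2 #>\<^bsub>?M2\<^esub> (y', \<zero>\<^bsub>?W2\<^esub>)) = ?J1 #>\<^bsub>?M1\<^esub> (\<psi> y', v)"
      using \<psi>(2)[OF y' W2.zero_closed] by blast
    show "commutes R T1 E1 (\<psi> y) (\<psi> y')"
      using arg_cong[OF comm, of \<Psi>] hom_mult[OF \<Psi>h coset2 coset2] y y' v w'
        cosets_commute_iff[OF T1 \<psi>c[OF y] \<psi>c[OF y'] w'(1) v(1)] by simp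
  qed (use graph1 graph2 \<phi>(1) \<psi>(1) in simp_all)
  show ?thesis by (rule graph_iso)
qed

section \<open>From graph isomorphisms to group isomorphisms\<close>

lemma graph_iso_imp_iso:
  fixes T1 :: "'t1 set" and T2 :: "'t2 set"
  assumes graph1: "simple_graph T1 E1" and graph2: "simple_graph T2 E2"
    and iso: "graph_iso T1 E1 T2 E2"
  shows "free_nil2_group R T1 Mod edge_subgroup R T1 E1 \<cong>
    free_nil2_group R T2 Mod edge_subgroup R T2 E2"
proof -
  let ?V1 = "free_mod R T1" and ?V2 = "free_mod R T2"
    and ?W1 = "ext_square R T1" and ?W2 = "ext_square R T2"
    and ?M1 = "free_nil2_group R T1" and ?M2 = "free_nil2_group R T2"
    and ?J1 = "edge_subgroup R T1 E1" and ?J2 = "edge_subgroup R T2 E2"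
  interpret M1: group ?M1 by (rule group_free_nil2_group[OF is_cring two_unit])
  interpret M2: group ?M2 by (rule group_free_nil2_group[OF is_cring two_unit])
  interpret J2: normal ?J2 ?M2 by (rule edge_subgroup_normal[OF is_cring two_unit])
  have T1: "finite T1" and T2: "finite T2" using graph1 graph2 by (simp_all add: simple_graph_def)
  obtain f where bij: "bij_betw f T1 T2"
    and edge: "\<And>u v. \<lbrakk>u \<in> T1; v \<in> T1\<rbrakk> \<Longrightarrow> {u, v} \<in> E1 \<longleftrightarrow> {f u, f v} \<in> E2"
    using iso unfolding graph_iso_def by blast
  define g where "g = inv_into T1 f"
  have f: "f u \<in> T2" if "u \<in> T1" for u using bij that by (auto simp: bij_betw_def)
  have g: "g u \<in> T1" if "u \<in> T2" for u
    unfolding g_def using bij_betw_inv_into[OF bij] that by (auto simp: bij_betw_def)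
  have gf: "g (f u) = u" if "u \<in> T1" for u
    unfolding g_def using bij that by (rule bij_betw_inv_into_left)
  have fg: "f (g u) = u" if "u \<in> T2" for u
    unfolding g_def using bij that by (rule bij_betw_inv_into_right)
  \<comment> \<open>Vectors and matrices are functions on vertices and pairs, so moving them along
    \<open>f\<close> means composing with its inverse \<open>g\<close>.\<close>
  define FV where "FV x = (\<lambda>u\<in>T2. x (g u))" for x :: "'t1 \<Rightarrow> int"
  define FW where "FW w = (\<lambda>(u, v)\<in>T2 \<times> T2. w (g u, g v))" for w :: "'t1 \<times> 't1 \<Rightarrow> int"
  define F where "F = map_prod FV FW"
  have FV: "FV x \<in> carrier ?V2" if "x \<in> carrier ?V1" for x
    using g free_mod_mem[OF that] by (auto simp: FV_def free_mod_simps(1))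
  have FW: "FW w \<in> carrier ?W2" if w: "w \<in> carrier ?W1" for w
  proof (rule ext_squareI)
    fix u v assume "u \<in> T2" "v \<in> T2"
    then show "FW w (v, u) = \<ominus> FW w (u, v)"
      using g ext_square_mem(4)[OF w, of "g u" "g v"] by (simp add: FW_def)
  qed (use g ext_square_mem(2,3)[OF w] in \<open>auto simp: FW_def\<close>)
  have F_hom: "F \<in> hom ?M1 ?M2"
  proof (rule homI)
    fix h assume "h \<in> carrier ?M1"
    then show "F h \<in> carrier ?M2"
      using FV FW by (cases h) (simp add: F_def free_nil2_group_simps(1))
    fix h' assume "h' \<in> carrier ?M1"
    show "F (h \<otimes>\<^bsub>?M1\<^esub> h') = F h \<otimes>\<^bsub>?M2\<^esub> F h'"
    proof (cases h, cases h')
      fix x w x' w' assume "h = (x, w)" "h' = (x', w')"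
      then show ?thesis
        using g by (auto simp: F_def FV_def FW_def free_nil2_group_simps(2) free_mod_simps(3)
            ext_square_simps(3,4) wedge_def fun_eq_iff)
    qed
  qed
  \<comment> \<open>Membership in either edge subgroup is a vanishing condition on coordinates, and
    the relabelling matches non-edges with non-edges.\<close>
  have F_mem: "F h \<in> ?J2 \<longleftrightarrow> h \<in> ?J1" if h: "h \<in> carrier ?M1" for h
  proof -
    obtain x w where xw: "h = (x, w)" "x \<in> carrier ?V1" "w \<in> carrier ?W1"
      using h by (auto simp: free_nil2_group_simps(1))
    have x_eq: "FV x = \<zero>\<^bsub>?V2\<^esub> \<longleftrightarrow> x = \<zero>\<^bsub>?V1\<^esub>"
    proof
      assume 0: "FV x = \<zero>\<^bsub>?V2\<^esub>"
      show "x = \<zero>\<^bsub>?V1\<^esub>"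
      proof (rule PiE_ext[of _ T1 "\<lambda>_. carrier R"])
        fix u assume u: "u \<in> T1"
        show "x u = \<zero>\<^bsub>?V1\<^esub> u"
          using fun_cong[OF 0, of "f u"] u f gf by (simp add: FV_def free_mod_simps(2))
      qed (use xw in \<open>auto simp: free_mod_simps(1,2)\<close>)
    qed (use g in \<open>auto simp: FV_def free_mod_simps(2)\<close>)
    have "(\<forall>u\<in>T2. \<forall>v\<in>T2. {u, v} \<notin> E2 \<longrightarrow> FW w (u, v) = \<zero>) \<longleftrightarrow>
        (\<forall>u\<in>T1. \<forall>v\<in>T1. {f u, f v} \<notin> E2 \<longrightarrow> FW w (f u, f v) = \<zero>)"
      using f g fg by metis
    also have "\<dots> \<longleftrightarrow> (\<forall>u\<in>T1. \<forall>v\<in>T1. {u, v} \<notin> E1 \<longrightarrow> w (u, v) = \<zero>)"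
      using f gf edge by (simp add: FW_def)
    finally show ?thesis
      using xw FW x_eq
      by (simp add: F_def mem_edge_subgroup_iff[OF T1] mem_edge_subgroup_iff[OF T2])
  qed
  have surj: "F ` carrier ?M1 = carrier ?M2"
  proof (intro subset_antisym subsetI)
    fix h assume "h \<in> carrier ?M2"
    then obtain y w where h: "h = (y, w)" "y \<in> carrier ?V2" "w \<in> carrier ?W2"
      by (auto simp: free_nil2_group_simps(1))
    define x where "x = (\<lambda>u\<in>T1. y (f u))"
    define v where "v = (\<lambda>(a, b)\<in>T1 \<times> T1. w (f a, f b))"
    have "x \<in> carrier ?V1"
      using f free_mod_mem[OF h(2)] by (auto simp: x_def free_mod_simps(1))
    moreover have "v \<in> carrier ?W1"
    proof (rule ext_squareI)
      fix a b assume "a \<in> T1" "b \<in> T1"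
      then show "v (b, a) = \<ominus> v (a, b)"
        using f ext_square_mem(4)[OF h(3), of "f a" "f b"] by (simp add: v_def)
    qed (use f ext_square_mem(2,3)[OF h(3)] in \<open>auto simp: v_def\<close>)
    moreover have "FV x = y"
    proof (rule PiE_ext[of _ T2 "\<lambda>_. carrier R"])
      show "FV x \<in> T2 \<rightarrow>\<^sub>E carrier R" using FV[OF calculation(1)] by (simp add: free_mod_simps(1))
      show "y \<in> T2 \<rightarrow>\<^sub>E carrier R" using h(2) by (simp add: free_mod_simps(1))
    qed (simp add: FV_def x_def g fg)
    moreover have "FW v = w"
    proof (rule PiE_ext[OF ext_square_mem(1)[OF FW[OF calculation(2)]] ext_square_mem(1)[OF h(3)]])
    qed (auto simp: FW_def v_def g fg)
    ultimately show "h \<in> F ` carrier ?M1"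
      using h(1) by (intro image_eqI[of _ _ "(x, v)"]) (simp_all add: F_def free_nil2_group_simps(1))
  qed (use F_hom in \<open>auto simp: hom_def\<close>)
  \<comment> \<open>The relabelling followed by the quotient map is onto with kernel
    \<open>?J1\<close>, so the first isomorphism theorem applies.\<close>
  define H where "H = (\<lambda>h. ?J2 #>\<^bsub>?M2\<^esub> F h)"
  have H_hom: "H \<in> hom ?M1 (?M2 Mod ?J2)"
    using hom_compose[OF F_hom J2.r_coset_hom_Mod] by (simp add: H_def comp_def)
  interpret H: group_hom ?M1 "?M2 Mod ?J2" H
    by (intro group_hom.intro group_hom_axioms.intro M1.group_axioms J2.factorgroup_is_group H_hom)
  have "H ` carrier ?M1 = (\<lambda>h. ?J2 #>\<^bsub>?M2\<^esub> h) ` F ` carrier ?M1" by (simp add: H_def image_image)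
  also have "\<dots> = carrier (?M2 Mod ?J2)"
    unfolding surj by (auto simp: FactGroup_def RCOSETS_def)
  finally have onto: "H ` carrier ?M1 = carrier (?M2 Mod ?J2)" .
  have "H h = ?J2 \<longleftrightarrow> h \<in> ?J1" if h: "h \<in> carrier ?M1" for h
  proof -
    have "F h \<in> carrier ?M2" using F_hom h by (rule hom_in_carrier)
    then have "?J2 #>\<^bsub>?M2\<^esub> F h = ?J2 \<longleftrightarrow> F h \<in> ?J2"
      using M2.coset_join1[OF _ _ J2.subgroup_axioms] M2.coset_join2[OF _ J2.subgroup_axioms] by blast
    then show ?thesis using F_mem[OF h] by (simp add: H_def)
  qed
  then have "kernel ?M1 (?M2 Mod ?J2) H = ?J1"
    using normal_imp_subgroup[OF edge_subgroup_normal[OF is_cring two_unit, of T1 E1]]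
    by (auto simp: kernel_def FactGroup_def dest: subgroup.mem_carrier)
  then show ?thesis using H.FactGroup_iso[OF onto] by simp
qed

end

theorem theorem2:
  fixes p :: nat
    and T1 :: "'a set" and E1 :: "'a set set"
    and T2 :: "'b set" and E2 :: "'b set set"
  assumes "prime p" and "p \<noteq> 2"
    and "simple_graph T1 E1" and "simple_graph T2 E2"
  shows "graph_p_group p T1 E1 \<cong> graph_p_group p T2 E2 \<longleftrightarrow> graph_iso T1 E1 T2 E2"
proof -
  interpret odd_residues p "residue_ring (int p)"
    by unfold_locales (use assms in simp_all)
  show ?thesis
    unfolding graph_p_group_def
    using iso_imp_graph_iso graph_iso_imp_iso assms(3,4) by blast
qed

end
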